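(* Let $f\not\equiv 0$ be an odd entire function $\mathbb{C}\to\mathbb{C}$ such that for all $x,y,z,w\in\mathbb{C}$ $$f(x)f(y)f(z)f(w)-f\Big(\tfrac{x+y+z-w}{2}\Big)f\Big(\tfrac{x+y-z+w}{2}\Big)f\Big(\tfrac{x-y+z+w}{2}\Big)f\Big(\tfrac{-x+y+z+w}{2}\Big)$$ $$-f\Big(\tfrac{x+y+z+w}{2}\Big)f\Big(\tfrac{x+y-z-w}{2}\Big)f\Big(\tfrac{x-y+z-w}{2}\Big)f\Big(\tfrac{x-y-z+w}{2}\Big)=0.$$ Then there exist $\alpha,\beta\in\mathbb{C}$ such that one of the following holds: (1) $f(z)=z\,e^{\alpha z^2+\beta}$ for all $z$; (2) $f(z)=\sin(az)\,e^{\alpha z^2+\beta}$ for all $z$, for some $a\in\mathbb{C}$, $a\neq 0$; (3) $f(z)=\sigma(z,\Lambda)\,e^{\alpha z^2+\beta}$ for all $z$, for some lattice $\Lambda\subset\mathbb{C}$.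
   Context: A lattice $\Lambda\subset\mathbb{C}$ is a subgroup of the form $\omega_1\mathbb{Z}+\omega_2\mathbb{Z}$ with $\omega_1,\omega_2$ linearly independent over $\mathbb{R}$. Writing $\Lambda'=\Lambda\setminus\{0\}$, the Weierstrass sigma function is $$\sigma(z,\Lambda)=z\prod_{\lambda\in\Lambda'}\Big(1-\frac{z}{\lambda}\Big)\exp\Big(\frac{z}{\lambda}+\frac12\Big(\frac{z}{\lambda}\Big)^2\Big).$$ *)

theory Defs
  imports "HOL-Analysis.Analysis"
begin

definition is_lattice :: "complex set \<Rightarrow> bool" where
  "is_lattice L \<longleftrightarrow> (\<exists>w1 w2.
      (\<forall>a b :: real. of_real a * w1 + of_real b * w2 = 0 \<longrightarrow> a = 0 \<and> b = 0) \<and>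
      L = {of_int m * w1 + of_int n * w2 | m n :: int. True})"

text \<open>Weierstrass sigma function. The infinite product over the nonzero lattice points
  converges absolutely, so it is the limit of the finite partial products over
  the nonzero lattice points of modulus at most R, as R tends to infinity.\<close>
definition weierstrass_sigma :: "complex \<Rightarrow> complex set \<Rightarrow> complex" where
  "weierstrass_sigma z L =
     Lim at_top (\<lambda>R::real. z * (\<Prod>l\<in>{l\<in>L - {0}. norm l \<le> R}.
         (1 - z / l) * exp (z / l + (z / l)^2 / 2)))"

end

theory Submission
  imports Defs "HOL-Complex_Analysis.Complex_Analysis"
begin

text \<open>Substituting \<open>x = a + b\<close>, \<open>y = a - b\<close>, \<open>z = c + d\<close>, \<open>w = c - d\<close> turns the equation into Weierstrass'
three-term equation. Its leading terms at the origin force a simple zero there; then all zeros of \<open>f\<close>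
are simple and form a discrete subgroup \<open>L\<close>, and \<open>f'/f\<close> changes by a constant under each period \<open>u \<in> L\<close>.

If \<open>L = 0\<close> or \<open>L\<close> is cyclic, write \<open>f = S e\<^sup>g\<close> with \<open>S z = z\<close> or \<open>S z = sin (a z)\<close>. The quotient
\<open>\<phi>\<^sub>c(z) = f(z + c) f(z - c) / (f(z)\<^sup>2 f(c)\<^sup>2)\<close> takes equal values only at points that agree modulo sign
and \<open>L\<close>; by the open mapping theorem it is bounded away from \<open>0\<close> far from the zeros. Hence
\<open>exp (2 g(z) - g(z + c) - g(z - c))\<close> is bounded, so constant, and \<open>g\<close> is quadratic.

If \<open>L\<close> is a lattice, \<open>H = f'/f - \<zeta>\<close> is entire for the Weierstrass zeta function \<open>\<zeta>\<close> of \<open>L\<close>. Second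
differences of \<open>H\<close> are elliptic and entire, hence constant; as \<open>H\<close> is odd, it is linear. Integrating the
tail of \<open>\<zeta>\<close> compares \<open>f\<close> with the partial products of \<open>\<sigma>\<close>, which also proves their convergence.\<close>

section \<open>Entire functions\<close>

text \<open>This is the identity theorem on the nonempty open set where \<open>M\<close> does not
  vanish. It lets identities be divided by factors that have zeros.\<close>

lemma entire_cancel:
  assumes A: "A holomorphic_on UNIV" and B: "B holomorphic_on UNIV" and M: "M holomorphic_on UNIV"
    and M0: "M y \<noteq> 0" and eq: "\<And>z. A z * M z = B z * M z"
  shows "A z = B z"
proof (rule analytic_continuation_open[of "{z. M z \<noteq> 0}" UNIV A B])
  show "open {z. M z \<noteq> 0}"
    using open_Collect_neq[OF holomorphic_on_imp_continuous_on[OF M] continuous_on_const] by simp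
qed (use assms in auto)

text \<open>Riemann's theorem removes the singularity at one point; since the points of
  \<open>L\<close> are isolated, the local extensions fit together.\<close>

lemma holomorphic_extend_discrete:
  assumes isol: "\<And>z. \<exists>e>0. ball z e \<inter> L \<subseteq> {z}"
    and h: "h holomorphic_on - L"
    and lim: "\<And>l. l \<in> L \<Longrightarrow> ((\<lambda>z. (z - l) * h z) \<longlongrightarrow> 0) (at l)"
  obtains H where "H holomorphic_on UNIV" "\<And>z. z \<notin> L \<Longrightarrow> H z = h z"
proof -
  define H where "H z = (if z \<in> L then Lim (at z) h else h z)" for z
  have "\<exists>e>0. H holomorphic_on ball z e" for z
  proof -
    obtain e where e: "e > 0" "ball z e \<inter> L \<subseteq> {z}" using isol by blast
    show ?thesis
    proof (cases "z \<in> L")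
      case False
      then have sub: "ball z e \<subseteq> - L" using e by auto
      have "H holomorphic_on ball z e"
        by (rule holomorphic_transform[OF holomorphic_on_subset[OF h sub]]) (use sub H_def in auto)
      with e show ?thesis by blast
    next
      case True
      have hz: "h holomorphic_on ball z e - {z}"
        by (rule holomorphic_on_subset[OF h]) (use e in auto)
      obtain g where g: "g holomorphic_on ball z e" "\<And>w. w \<in> ball z e - {z} \<Longrightarrow> g w = h w"
        using holomorphic_on_extend_lim[OF hz] lim[OF True] e by auto
      have "(g \<longlongrightarrow> g z) (at z)"
        using g(1) e by (metis centre_in_ball continuous_on_eq_continuous_at holomorphic_on_imp_continuous_on isCont_def open_ball)
      moreover have "\<forall>\<^sub>F w in at z. g w = h w"
        unfolding eventually_at using e g(2) by (intro exI[of _ e]) (auto simp: dist_commute)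
      ultimately have "(h \<longlongrightarrow> g z) (at z)"
        by (metis (mono_tags, lifting) tendsto_cong)
      then have "H z = g z" unfolding H_def using True by (simp add: tendsto_Lim)
      moreover have "H w = g w" if "w \<in> ball z e - {z}" for w
        using that e g(2) by (auto simp: H_def)
      ultimately have "H holomorphic_on ball z e"
        by (intro holomorphic_transform[OF g(1)]) fastforce
      with e show ?thesis by blast
    qed
  qed
  then have "H holomorphic_on UNIV"
    by (metis UNIV_I at_within_open centre_in_ball holomorphic_on_def holomorphic_on_imp_differentiable_at open_ball open_UNIV)
  moreover have "H z = h z" if "z \<notin> L" for z using that by (simp add: H_def)
  ultimately show thesis using that by blast
qed

lemma entire_mult_nonzero:
  assumes A: "A holomorphic_on UNIV" and B: "B holomorphic_on UNIV" and "A x \<noteq> 0" "B y \<noteq> 0"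
  obtains z where "A z * B z \<noteq> 0"
proof -
  have False if "\<And>z. A z * B z = 0"
    using entire_cancel[OF A holomorphic_on_const[of 0] B \<open>B y \<noteq> 0\<close>, of x] that \<open>A x \<noteq> 0\<close> by simp
  then show thesis using that by blast
qed

lemma holomorphic_shift:
  fixes F :: "complex \<Rightarrow> complex"
  assumes "F holomorphic_on UNIV"
  shows "(\<lambda>z. F (z + k)) holomorphic_on UNIV"
  by (intro holomorphic_on_compose_gen[OF _ assms, unfolded o_def] holomorphic_intros) simp

lemma entire_bounded_on_cball:
  assumes "h holomorphic_on UNIV"
  obtains N where "\<And>z. norm z \<le> R \<Longrightarrow> norm (h z) \<le> N"
proof -
  have "compact (h ` cball 0 R)"
    by (intro compact_continuous_image holomorphic_on_imp_continuous_on holomorphic_on_subset[OF assms]) auto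
  then obtain N where "\<forall>x\<in>h ` cball 0 R. norm x \<le> N"
    using compact_imp_bounded bounded_iff by metis
  then show thesis by (intro that[of N]) auto
qed

lemma holomorphic_second_difference:
  assumes g: "g holomorphic_on UNIV"
  shows "(\<lambda>z. exp (2 * g z - g (z + c) - g (z - c))) holomorphic_on UNIV"
  using holomorphic_shift[OF g, of c] holomorphic_shift[OF g, of "- c"] g
  by (intro holomorphic_intros) auto

lemma entire_has_deriv:
  assumes "f holomorphic_on UNIV"
  shows "(f has_field_derivative deriv f z) (at z)"
  using assms holomorphic_derivI by blast

lemma entire_zeros_isolated:
  assumes f: "f holomorphic_on UNIV" and nz: "f z0 \<noteq> 0"
  shows "\<exists>e>0. ball z e \<inter> {z. f z = 0} \<subseteq> {z}"
proof (cases "f z = 0")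
  case True
  then obtain r where "0 < r" "\<And>w. w \<in> ball z r - {z} \<Longrightarrow> f w \<noteq> 0"
    using isolated_zeros[OF f _ _ _ True _ nz] by auto
  then show ?thesis by (intro exI[of _ r]) force
next
  case False
  have "open {z. f z \<noteq> 0}"
    using open_Collect_neq[OF holomorphic_on_imp_continuous_on[OF f] continuous_on_const] by simp
  then obtain e where "e > 0" "ball z e \<subseteq> {z. f z \<noteq> 0}"
    using False open_contains_ball by blast
  then show ?thesis by blast
qed

lemma entire_zeros_finite:
  assumes f: "f holomorphic_on UNIV" and nz: "f z0 \<noteq> 0"
  shows "finite {z. f z = 0 \<and> norm z \<le> r}"
proof (cases "f constant_on UNIV")
  case True
  then have "f z \<noteq> 0" for z using nz by (metis UNIV_I constant_on_def)
  then show ?thesis by simp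
next
  case False
  have "finite {z \<in> cball 0 r. f z = 0}"
    by (rule holomorphic_compact_finite_zeros[OF f]) (use False in auto)
  then show ?thesis by (rule rev_finite_subset) auto
qed

section \<open>Quotients with common simple zeros, and exponents with constant second
  differences\<close>

lemma simple_zero_quotient:
  assumes f: "f holomorphic_on UNIV" and f0: "f u = 0"
  shows "((\<lambda>z. f z / (z - u)) \<longlongrightarrow> deriv f u) (at u)"
  using entire_has_deriv[OF f, of u] f0 by (simp add: has_field_derivative_iff)

text \<open>The simple zeros cancel, so \<open>f / S\<close> extends to a zero-free entire function,
  which has a logarithm because the plane is contractible.\<close>

lemma entire_quotient_exp:
  assumes f: "f holomorphic_on UNIV" and S: "S holomorphic_on UNIV"
    and zeros: "\<And>z. f z = 0 \<longleftrightarrow> S z = 0"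
    and simple: "\<And>z. f z = 0 \<Longrightarrow> deriv f z \<noteq> 0 \<and> deriv S z \<noteq> 0"
    and nz: "f z0 \<noteq> 0"
  obtains g where "g holomorphic_on UNIV" "\<And>z. f z = S z * exp (g z)"
proof -
  let ?L = "{z. f z = 0}"
  have isol: "\<exists>e>0. ball z e \<inter> ?L \<subseteq> {z}" for z
    by (rule entire_zeros_isolated[OF f nz])
  have h: "(\<lambda>z. f z / S z) holomorphic_on - ?L"
    by (intro holomorphic_intros holomorphic_on_subset[OF f] holomorphic_on_subset[OF S]) (use zeros in auto)
  have lim: "((\<lambda>z. (z - l) * (f z / S z)) \<longlongrightarrow> 0) (at l)" if "l \<in> ?L" for l
  proof -
    \<comment> \<open>Numerator and denominator become difference quotients at \<open>l\<close>, so
      their ratio has a finite limit and the extra factor \<open>z - l\<close> forces the limit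
      0.\<close>
    have "((\<lambda>z. (z - l) * ((f z / (z - l)) / (S z / (z - l)))) \<longlongrightarrow> (l - l) * (deriv f l / deriv S l)) (at l)"
      by (intro tendsto_intros simple_zero_quotient[OF f] simple_zero_quotient[OF S])
         (use that zeros simple in auto)
    then have "((\<lambda>z. (z - l) * ((f z / (z - l)) / (S z / (z - l)))) \<longlongrightarrow> 0) (at l)" by simp
    moreover have "\<forall>\<^sub>F z in at l. (z - l) * ((f z / (z - l)) / (S z / (z - l))) = (z - l) * (f z / S z)"
      by (auto simp: eventually_at_filter)
    ultimately show ?thesis by (rule Lim_transform_eventually)
  qed
  obtain q where q: "q holomorphic_on UNIV" "\<And>z. z \<notin> ?L \<Longrightarrow> q z = f z / S z"
    using holomorphic_extend_discrete[OF isol h lim] by blast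
  have fq: "f z = S z * q z" for z
    using q(2)[of z] zeros[of z] by (cases "f z = 0") simp_all
  have "q z \<noteq> 0" for z
  proof (cases "f z = 0")
    case True
    \<comment> \<open>Differentiating \<open>f = S q\<close> at a zero leaves
      \<open>f' = S' q\<close>, so a zero of \<open>q\<close> would make the zero of
      \<open>f\<close> multiple.\<close>
    have "((\<lambda>z. S z * q z) has_field_derivative S z * deriv q z + deriv S z * q z) (at z)"
      by (rule derivative_eq_intros entire_has_deriv[OF S] entire_has_deriv[OF q(1)])+ simp
    moreover have "(\<lambda>z. S z * q z) = f" using fq by (intro ext) simp
    ultimately have "deriv f z = S z * deriv q z + deriv S z * q z" using DERIV_imp_deriv by metis
    then have "deriv f z = deriv S z * q z"
      using True zeros[of z] by simp
    then show ?thesis using simple[OF True] by auto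
  next
    case False
    then show ?thesis using fq by auto
  qed
  then obtain g where g: "g holomorphic_on UNIV" "\<And>z. z \<in> UNIV \<Longrightarrow> q z = exp (g z)"
    using contractible_imp_holomorphic_log[OF q(1) contractible_UNIV] by metis
  show thesis
    by (rule that[OF g(1)]) (simp only: fq g(2)[OF UNIV_I])
qed

text \<open>Differentiating the hypothesis in \<open>h\<close> gives \<open>k'(z + h) = k'(z - h)\<close>.\<close>
lemma midpoint_affine:
  fixes k :: "complex \<Rightarrow> complex"
  assumes k: "k holomorphic_on UNIV" and d: "\<delta> > 0"
    and mid: "\<And>z h. h \<noteq> 0 \<Longrightarrow> norm h < \<delta> \<Longrightarrow> k (z + h) + k (z - h) = 2 * k z"
  obtains c d where "\<And>z. k z = c * z + d"
proof -
  have eq: "deriv k (z + h) = deriv k (z - h)" if h: "norm h < \<delta>" for z h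
  proof (cases "h = 0")
    case False
    have D: "((\<lambda>h. k (z + h) + k (z - h)) has_field_derivative deriv k (z + h) - deriv k (z - h)) (at h)"
      by (rule derivative_eq_intros DERIV_chain2[OF entire_has_deriv[OF k]] | simp)+
    have "open (ball 0 \<delta> - {0::complex})" by auto
    then have "\<forall>\<^sub>F w in nhds h. w \<in> ball 0 \<delta> - {0}"
      by (rule eventually_nhds_in_open) (use h False in auto)
    then have "\<forall>\<^sub>F w in nhds h. k (z + w) + k (z - w) = 2 * k z"
      by eventually_elim (use mid in auto)
    then have "((\<lambda>h. 2 * k z) has_field_derivative deriv k (z + h) - deriv k (z - h)) (at h)"
      using D by (simp add: DERIV_cong_ev)
    then have "deriv k (z + h) - deriv k (z - h) = 0"
      using DERIV_unique DERIV_const by blast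
    then show ?thesis by simp
  qed simp
  have "(deriv k has_field_derivative 0) (at w)" for w
  proof -
    have "\<forall>\<^sub>F y in nhds w. deriv k y = deriv k w"
    proof -
      have "\<forall>\<^sub>F y in nhds w. y \<in> ball w \<delta>"
        by (rule eventually_nhds_in_open) (use d in auto)
      then show ?thesis
      proof eventually_elim
        case (elim y)
        \<comment> \<open>The points \<open>y\<close> and \<open>w\<close> are
          \<open>(y + w) / 2\<close> plus and minus \<open>(y - w) / 2\<close>, so \<open>eq\<close>
          makes \<open>deriv k\<close> locally constant.\<close>
        have "norm ((y - w) / 2) < \<delta>" using elim d by (simp add: dist_norm norm_minus_commute norm_divide)
        from eq[OF this, of "(y + w) / 2"] show ?case by (simp add: field_simps)
      qed
    qed
    then show ?thesis
      by (subst DERIV_cong_ev[OF refl _ refl]) auto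
  qed
  then obtain c where c: "deriv k z = c" for z
    using has_field_derivative_0_imp_constant_on[of UNIV "deriv k"] by (auto simp: constant_on_def)
  have "((\<lambda>z. k z - c * z) has_field_derivative 0) (at w)" for w
    by (rule derivative_eq_intros entire_has_deriv[OF k] | simp add: c)+
  then obtain d where "k z - c * z = d" for z
    using has_field_derivative_0_imp_constant_on[of UNIV "\<lambda>z. k z - c * z"] by (auto simp: constant_on_def)
  then show thesis by (intro that[of c d]) (metis add.commute diff_add_cancel)
qed

text \<open>A constant exponential has derivative 0, so the second differences of
  \<open>deriv g\<close> vanish; by \<open>midpoint_affine\<close> this derivative is
  affine.\<close>

lemma quadratic_of_second_differences:
  fixes g :: "complex \<Rightarrow> complex"
  assumes g: "g holomorphic_on UNIV" and d: "\<delta> > 0"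
    and E: "\<And>h. h \<noteq> 0 \<Longrightarrow> norm h < \<delta> \<Longrightarrow> (\<lambda>z. exp (2 * g z - g (z + h) - g (z - h))) constant_on UNIV"
  obtains a b c where "\<And>z. g z = a * z\<^sup>2 + b * z + c"
proof -
  have dg: "deriv g holomorphic_on UNIV" using g by (simp add: holomorphic_deriv)
  have "deriv g (z + h) + deriv g (z - h) = 2 * deriv g z" if h: "h \<noteq> 0" "norm h < \<delta>" for z h
  proof -
    obtain C where C: "exp (2 * g z - g (z + h) - g (z - h)) = C" for z
      using E[OF h] by (auto simp: constant_on_def)
    have "((\<lambda>z. exp (2 * g z - g (z + h) - g (z - h))) has_field_derivative
        exp (2 * g z - g (z + h) - g (z - h)) * (2 * deriv g z - deriv g (z + h) - deriv g (z - h))) (at z)"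
      by (rule derivative_eq_intros entire_has_deriv[OF g] DERIV_chain2[OF entire_has_deriv[OF g]] | simp)+
    then have "exp (2 * g z - g (z + h) - g (z - h)) * (2 * deriv g z - deriv g (z + h) - deriv g (z - h)) = 0"
      using DERIV_unique DERIV_const unfolding C by blast
    then have "2 * deriv g z - deriv g (z + h) - deriv g (z - h) = 0"
      by (metis exp_not_eq_zero mult_eq_0_iff)
    then show ?thesis by (simp add: algebra_simps)
  qed
  then obtain c d where cd: "\<And>z. deriv g z = c * z + d" using midpoint_affine[OF dg d] by metis
  have "((\<lambda>z. g z - (c/2 * z\<^sup>2 + d * z)) has_field_derivative 0) (at w)" for w
    by (rule derivative_eq_intros entire_has_deriv[OF g] | simp add: cd)+
  then obtain e where "g z - (c/2 * z\<^sup>2 + d * z) = e" for z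
    using has_field_derivative_0_imp_constant_on[of UNIV "\<lambda>z. g z - (c/2 * z\<^sup>2 + d * z)"] by (auto simp: constant_on_def)
  then have "g z = c/2 * z\<^sup>2 + d * z + e" for z by (metis add.commute diff_add_cancel)
  then show thesis by (rule that)
qed

text \<open>Comparing the values at \<open>z\<close> and \<open>- z\<close> gives
  \<open>exp (2 * b * z) = 1\<close> off the zeros of \<open>S\<close>, hence everywhere, which
  forces \<open>b = 0\<close>.\<close>

lemma odd_quotient_even_exponent:
  fixes f S :: "complex \<Rightarrow> complex"
  assumes S: "S holomorphic_on UNIV" "S z0 \<noteq> 0" "\<And>z. S (- z) = - S z" "\<And>z. f (- z) = - f z"
    and eq: "\<And>z. f z = S z * exp (a * z\<^sup>2 + b * z + c)"
  shows "f z = S z * exp (a * z\<^sup>2 + c)"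
proof -
  have "exp (2 * b * z) = 1" for z
  proof (rule entire_cancel[where A = "\<lambda>z. exp (2 * b * z)" and B = "\<lambda>_. 1", OF _ _ S(1,2)])
    show "exp (2 * b * z) * S z = 1 * S z" for z
    proof -
      have e: "exp (a * z\<^sup>2 + b * z + c) = exp (a * z\<^sup>2 + c) * exp (b * z)"
          "exp (a * z\<^sup>2 - b * z + c) = exp (a * z\<^sup>2 + c) * exp (- (b * z))"
        by (simp_all flip: exp_add add: algebra_simps)
      have "S z * exp (a * z\<^sup>2 + b * z + c) = S z * exp (a * z\<^sup>2 - b * z + c)"
        using eq[of z] eq[of "- z"] S(3,4) by simp
      then have "S z * exp (b * z) = S z * exp (- (b * z))"
        unfolding e by simp
      then have "S z * exp (b * z) * exp (b * z) = S z * (exp (- (b * z)) * exp (b * z))"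
        by simp
      also have "exp (- (b * z)) * exp (b * z) = 1" by (simp flip: exp_add)
      finally have "S z * (exp (b * z) * exp (b * z)) = S z" by (simp add: mult.assoc)
      also have "exp (b * z) * exp (b * z) = exp (2 * b * z)" by (simp add: mult.assoc flip: exp_add)
      finally show ?thesis by (simp add: mult_ac)
    qed
  qed (auto intro!: holomorphic_intros)
  note one = this
  have "((\<lambda>z. exp (2 * b * z)) has_field_derivative 2 * b) (at 0)"
    by (rule derivative_eq_intros | simp)+
  then have "2 * b = 0" unfolding one using DERIV_unique DERIV_const by blast
  then show ?thesis using eq by simp
qed

text \<open>For \<open>w = x + iy\<close> the square of |sin w| is (exp(2y) + exp(-2y) - 2 cos(2x))
  / 4. If |y| \<ge> 1, the Taylor polynomial bounds the larger exponential below by 1 + 2 + 2 =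
  5.\<close>

lemma norm_sin_lower_bound:
  fixes w :: complex
  assumes "1 \<le> \<bar>Im w\<bar>"
  shows "3 / 4 \<le> (norm (sin w))\<^sup>2"
proof -
  define t where "t = 2 * \<bar>Im w\<bar>"
  have t: "2 \<le> t" using assms by (simp add: t_def)
  have "1 + t + t\<^sup>2 / 2 \<le> exp t" using t by (intro exp_lower_Taylor_quadratic) auto
  moreover have "2\<^sup>2 \<le> t\<^sup>2" using t by (intro power_mono) auto
  ultimately have "5 \<le> exp t" using t by simp
  moreover have "exp t + inverse (exp t) = exp (2 * Im w) + inverse (exp (2 * Im w))"
    by (cases "Im w \<ge> 0") (simp_all add: t_def exp_minus)
  moreover have "inverse (exp t) > 0" by simp
  moreover have "cos (2 * Re w) \<le> 1" by simp
  ultimately have "3 \<le> exp (2 * Im w) + inverse (exp (2 * Im w)) - 2 * cos (2 * Re w)" by linarith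
  then show ?thesis by (simp add: norm_sin_squared)
qed

text \<open>For the sine this plays the role of (x + y)(x - y) = x^2 - y^2 for
  \<open>S z = z\<close>: both bound \<open>S (z + c) * S (z - c)\<close> in terms of
  \<open>S z\<close>.\<close>

lemma sin_add_times_sin_diff:
  fixes x y :: complex
  shows "sin (x + y) * sin (x - y) = (sin x)\<^sup>2 - (sin y)\<^sup>2"
proof -
  have "(sin x)\<^sup>2 - (sin y)\<^sup>2 = (sin x)\<^sup>2 * (cos y)\<^sup>2 - (cos x)\<^sup>2 * (sin y)\<^sup>2"
    unfolding cos_squared_eq by (simp add: algebra_simps)
  also have "\<dots> = sin (x + y) * sin (x - y)"
    unfolding sin_add sin_diff by (simp add: power2_eq_square algebra_simps)
  finally show ?thesis by simp
qed

section \<open>Discrete subgroups of the plane\<close>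

text \<open>Lattice reduction: \<open>w1\<close> is a shortest nonzero point, \<open>w2\<close> a
  shortest point off the real line through \<open>w1\<close>. If they did not generate
  \<open>L\<close>, a remainder modulo them would be too short.\<close>

lemma discrete_subgroup_cases:
  fixes L :: "complex set"
  assumes zero: "0 \<in> L" and diff: "\<And>x y. x \<in> L \<Longrightarrow> y \<in> L \<Longrightarrow> x - y \<in> L"
    and fin: "\<And>r. finite {z. z \<in> L \<and> norm z \<le> r}"
  obtains "L = {0}"
    | w where "w \<noteq> 0" "L = {of_int n * w | n :: int. True}"
    | "is_lattice L"
proof -
  have neg: "- x \<in> L" if "x \<in> L" for x using diff[OF zero that] by simp
  have add: "x + y \<in> L" if "x \<in> L" "y \<in> L" for x y using diff[OF that(1) neg[OF that(2)]] by simp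
  have mult: "of_int n * x \<in> L" if x: "x \<in> L" for x and n :: int
  proof (induction n rule: int_induct[of _ 0])
    case (step1 i)
    then show ?case using add[OF _ x, of "of_int i * x"] by (simp add: algebra_simps)
  next
    case (step2 i)
    then show ?case using diff[OF _ x, of "of_int i * x"] by (simp add: algebra_simps)
  qed (simp add: zero)
  have min: "\<exists>w\<in>A. \<forall>z\<in>A. norm w \<le> norm z" if A: "A \<subseteq> L" "A \<noteq> {}" for A
  proof -
    obtain a where a: "a \<in> A" using A by blast
    have "finite {z \<in> A. norm z \<le> norm a}"
      using fin[of "norm a"] by (rule rev_finite_subset) (use A in auto)
    then obtain w where "w \<in> {z \<in> A. norm z \<le> norm a}"
      "\<And>z. z \<in> {z \<in> A. norm z \<le> norm a} \<Longrightarrow> norm w \<le> norm z"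
      using a by (metis (mono_tags, lifting) arg_min_if_finite(1) arg_min_least empty_iff mem_Collect_eq order_refl)
    then show ?thesis by (intro bexI[of _ w]) force+
  qed
  show thesis
  proof (cases "L = {0}")
    case False
    then have "L - {0} \<noteq> {}" using zero by auto
    then obtain w1 where w1: "w1 \<in> L" "w1 \<noteq> 0" "\<And>z. z \<in> L \<Longrightarrow> z \<noteq> 0 \<Longrightarrow> norm w1 \<le> norm z"
      using min[of "L - {0}"] by auto
    \<comment> \<open>Subtracting the integer part of \<open>t\<close> leaves a multiple of
      \<open>w1\<close> shorter than \<open>w1\<close>, which must be 0.\<close>
    have line: "t = of_int \<lfloor>t\<rfloor>" if "of_real t * w1 \<in> L" for t
    proof -
      have "of_real t * w1 - of_int \<lfloor>t\<rfloor> * w1 \<in> L" using diff[OF that mult[OF w1(1)]] .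
      moreover have eq: "of_real t * w1 - of_int \<lfloor>t\<rfloor> * w1 = of_real (t - of_int \<lfloor>t\<rfloor>) * w1"
        by (simp add: algebra_simps)
      moreover have "norm (of_real (t - of_int \<lfloor>t\<rfloor>) * w1) < norm w1"
      proof -
        have "\<bar>t - of_int \<lfloor>t\<rfloor>\<bar> < 1" by linarith
        then show ?thesis using w1(2) by (simp only: norm_mult norm_of_real) simp
      qed
      ultimately have "of_real (t - of_int \<lfloor>t\<rfloor>) * w1 = 0" using w1(3) by (metis not_le)
      then show ?thesis using w1(2) by (simp only: mult_eq_0_iff of_real_eq_0_iff) simp
    qed
    have line': "\<exists>n::int. of_real t * w1 = of_int n * w1" if "of_real t * w1 \<in> L" for t
      using line[OF that] by (metis of_real_of_int_eq)
    define A where "A = {z \<in> L. \<not> (\<exists>t::real. z = of_real t * w1)}"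
    show thesis
    proof (cases "A = {}")
      case True
      have "L = {of_int n * w1 | n :: int. True}"
        using True line' mult[OF w1(1)] by (auto simp: A_def)
      then show thesis using that(2) w1(2) by blast
    next
      case False
      then obtain w2 where w2: "w2 \<in> A" "\<And>z. z \<in> A \<Longrightarrow> norm w2 \<le> norm z"
        using min[of A] by (auto simp: A_def)
      define q where "q = w2 / w1"
      have w2q: "w2 = q * w1" using w1(2) by (simp add: q_def)
      have Imq: "Im q \<noteq> 0"
      proof
        assume "Im q = 0"
        then have "w2 = of_real (Re q) * w1" using w2q by (metis complex_is_Real_iff of_real_Re)
        with w2(1) show False by (auto simp: A_def)
      qed
      have w2L: "w2 \<in> L" using w2(1) by (simp add: A_def)
      have ind: "a = 0 \<and> b = 0" if "of_real a * w1 + of_real b * w2 = 0" for a b :: real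
      proof -
        have "(of_real a + of_real b * q) * w1 = 0" using that by (simp add: w2q algebra_simps)
        then have "of_real a + of_real b * q = 0" using w1(2) by simp
        then have "Re (of_real a + of_real b * q) = 0" "Im (of_real a + of_real b * q) = 0" by simp_all
        with Imq show ?thesis by auto
      qed
      \<comment> \<open>This is the minimality of \<open>w2\<close>, with all points measured in
        units of \<open>w1\<close>.\<close>
      have Anorm: "norm q \<le> norm (of_real s + of_real t * q)"
        if "(of_real s + of_real t * q) * w1 \<in> L" "t \<noteq> 0" for s t :: real
      proof -
        have "(of_real s + of_real t * q) * w1 \<noteq> of_real u * w1" for u :: real
        proof
          assume "(of_real s + of_real t * q) * w1 = of_real u * w1"
          then have "Im (of_real s + of_real t * q) = Im (of_real u)" using w1(2) by (metis mult_cancel_right)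
          with Imq that show False by auto
        qed
        then have "(of_real s + of_real t * q) * w1 \<in> A" using that by (auto simp: A_def)
        from w2(2)[OF this] show ?thesis
          using w1(2) by (simp add: w2q norm_mult)
      qed
      have q1: "norm q \<ge> 1"
      proof -
        have "q \<noteq> 0" using Imq by auto
        then show ?thesis using w1(3)[OF w2L] w1(2) by (simp add: w2q norm_mult)
      qed
      define x y where "x = Re q" and "y = Im q"
      have nsq: "(norm (of_real s + of_real t * q))\<^sup>2 = (s + t * x)\<^sup>2 + (t * y)\<^sup>2" for s t
        by (simp add: cmod_power2 x_def y_def)
      have nq: "(norm q)\<^sup>2 = x\<^sup>2 + y\<^sup>2" by (simp add: cmod_power2 x_def y_def)
      \<comment> \<open>As \<open>w2 + w1\<close> and \<open>w2 - w1\<close> are not shorter than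
        \<open>w2\<close>, the real part of \<open>q\<close> is at most 1/2 in absolute
        value.\<close>
      have "norm q \<le> norm (of_real 1 + of_real 1 * q)" "norm q \<le> norm (of_real (-1) + of_real 1 * q)"
        by (rule Anorm; use add[OF w2L w1(1)] diff[OF w2L w1(1)] in \<open>simp add: w2q algebra_simps\<close>)+
      then have "x\<^sup>2 + y\<^sup>2 \<le> (1 + 1 * x)\<^sup>2 + (1 * y)\<^sup>2" "x\<^sup>2 + y\<^sup>2 \<le> (-1 + 1 * x)\<^sup>2 + (1 * y)\<^sup>2"
        unfolding nq[symmetric] nsq[symmetric] by (auto intro: power_mono)
      then have absx: "\<bar>x\<bar> \<le> 1 / 2" by (simp add: power2_eq_square algebra_simps)
      have "L = {of_int m * w1 + of_int n * w2 | m n :: int. True}"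
      proof (intro equalityI subsetI)
        fix z assume "z \<in> {of_int m * w1 + of_int n * w2 | m n :: int. True}"
        then show "z \<in> L" using add mult w1(1) w2L by auto
      next
        fix z assume z: "z \<in> L"
        \<comment> \<open>These are the real coordinates of \<open>z\<close> in the basis
          \<open>w1\<close>, \<open>w2\<close>; rounding them leaves remainders \<open>s\<close>,
          \<open>t\<close> of size at most 1/2.\<close>
        define t0 s0 where "t0 = Im (z / w1) / y" and "s0 = Re (z / w1) - t0 * x"
        have "z / w1 = of_real s0 + of_real t0 * q"
          using Imq by (intro complex_eqI) (simp_all add: t0_def s0_def x_def y_def)
        then have z0: "z = (of_real s0 + of_real t0 * q) * w1" using w1(2) by (simp add: field_simps)
        define s t where "s = s0 - of_int (round s0)" and "t = t0 - of_int (round t0)"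
        have st: "\<bar>s\<bar> \<le> 1 / 2" "\<bar>t\<bar> \<le> 1 / 2"
          using of_int_round_abs_le[of s0] of_int_round_abs_le[of t0] by (auto simp: s_def t_def abs_minus_commute)
        have eq: "z - (of_int (round s0) * w1 + of_int (round t0) * w2) = (of_real s + of_real t * q) * w1"
          unfolding z0 s_def t_def w2q by (simp add: algebra_simps)
        have mu: "(of_real s + of_real t * q) * w1 \<in> L"
          unfolding eq[symmetric] by (intro diff add mult z w1 w2L)
        \<comment> \<open>With \<open>W\<close> the square of |q|, a nonzero \<open>t\<close> would
          give W \<le> 1/4 + 1/4 + W/4, so W \<le> 2/3, against W \<ge> 1.\<close>
        have "t = 0"
        proof (rule ccontr)
          assume "t \<noteq> 0"
          from Anorm[OF mu this] have "(norm q)\<^sup>2 \<le> (norm (of_real s + of_real t * q))\<^sup>2"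
            by (intro power_mono) auto
          then have 1: "x\<^sup>2 + y\<^sup>2 \<le> s\<^sup>2 + 2 * (s * t * x) + t\<^sup>2 * (x\<^sup>2 + y\<^sup>2)"
            unfolding nsq nq by (simp add: power2_eq_square algebra_simps)
          have sq: "s\<^sup>2 \<le> 1/4" "t\<^sup>2 \<le> 1/4"
            using st abs_le_square_iff[of s "1/2"] abs_le_square_iff[of t "1/2"] by (auto simp: power2_eq_square)
          have "\<bar>s * t * x\<bar> \<le> 1/2 * (1/2) * (1/2)"
            unfolding abs_mult by (intro mult_mono st absx) auto
          then have "s * t * x \<le> 1/8" by linarith
          moreover have "1 \<le> x\<^sup>2 + y\<^sup>2" unfolding nq[symmetric] using q1 by simp
          moreover have "t\<^sup>2 * (x\<^sup>2 + y\<^sup>2) \<le> 1/4 * (x\<^sup>2 + y\<^sup>2)"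
            using sq(2) by (rule mult_right_mono) auto
          moreover define W where "W = x\<^sup>2 + y\<^sup>2"
          ultimately have "1 \<le> W" "t\<^sup>2 * W \<le> 1/4 * W" "W \<le> s\<^sup>2 + 2 * (s * t * x) + t\<^sup>2 * W" "s * t * x \<le> 1/8"
            using 1 by simp_all
          then show False using sq(1) by linarith
        qed
        then obtain k :: int where "of_real s * w1 = of_int k * w1" using mu line' by auto
        then have "z = of_int (round s0 + k) * w1 + of_int (round t0) * w2"
          using eq \<open>t = 0\<close> by (simp add: algebra_simps)
        then show "z \<in> {of_int m * w1 + of_int n * w2 | m n :: int. True}" by blast
      qed
      then show thesis using that(3) ind unfolding is_lattice_def by blast
    qed
  qed (use that in blast)
qed

section \<open>Summation over a lattice and lattice-periodic functions\<close>

lemma summable_on_int_powr: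
  fixes s :: real
  assumes s: "s < -1"
  shows "(\<lambda>m::int. (1 + \<bar>of_int m\<bar>) powr s) summable_on UNIV"
proof -
  let ?a = "\<lambda>m::int. (1 + \<bar>of_int m\<bar>) powr s"
  have "summable (\<lambda>n. of_nat (Suc n) powr s :: real)"
    using s by (subst summable_Suc_iff) (simp add: summable_real_powr_iff)
  then have nat: "(\<lambda>n::nat. (1 + of_nat n) powr s :: real) summable_on UNIV"
    by (subst summable_on_UNIV_nonneg_real_iff) (simp_all add: add.commute)
  have 1: "?a summable_on range (\<lambda>n. int n)"
    by (subst summable_on_reindex) (use nat in \<open>auto simp: o_def inj_on_def\<close>)
  have 2: "?a summable_on range (\<lambda>n. - int n)"
    by (subst summable_on_reindex) (use nat in \<open>auto simp: o_def inj_on_def\<close>)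
  have 3: "?a summable_on (range (\<lambda>n. - int n) - range int)"
    by (rule summable_on_subset_banach[OF 2]) auto
  have "?a summable_on (range (\<lambda>n. int n) \<union> (range (\<lambda>n. - int n) - range int))"
    by (rule summable_on_Un_disjoint[OF 1 3]) auto
  also have "range int \<union> (range (\<lambda>n. - int n) - range int) = UNIV"
    by (auto simp: image_iff) (metis int_cases2)
  finally show ?thesis .
qed

lemma summable_on_int_pairs_powr:
  fixes s :: real
  assumes s: "s < -1"
  shows "(\<lambda>(m::int, n::int). ((1 + \<bar>of_int m\<bar>) * (1 + \<bar>of_int n\<bar>)) powr s) summable_on UNIV \<times> UNIV"
proof -
  define a where "a m = (1 + \<bar>of_int m\<bar>) powr s" for m :: int
  have a: "a summable_on UNIV" unfolding a_def by (rule summable_on_int_powr[OF s])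
  have "(\<lambda>(m, n). a m * a n) summable_on Sigma UNIV (\<lambda>_. UNIV)"
  proof (rule summable_on_SigmaI)
    show "((\<lambda>n. case (m, n) of (m, n) \<Rightarrow> a m * a n) has_sum (a m * infsum a UNIV)) UNIV" for m
      using has_sum_cmult_right[OF has_sum_infsum[OF a]] by simp
    show "(\<lambda>m. a m * infsum a UNIV) summable_on UNIV"
      by (rule summable_on_cmult_left[OF a])
  qed (simp add: a_def)
  then show ?thesis by (simp add: a_def powr_mult)
qed

lemma independent_imp_Im_neq_0:
  assumes ind: "\<And>a b :: real. of_real a * w1 + of_real b * w2 = 0 \<Longrightarrow> a = 0 \<and> b = 0"
  shows "w1 \<noteq> 0" "Im (w2 / w1) \<noteq> 0"
proof -
  show w1: "w1 \<noteq> 0" using ind[of 1 0] by auto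
  show "Im (w2 / w1) \<noteq> 0"
  proof
    assume "Im (w2 / w1) = 0"
    then have "w2 / w1 = of_real (Re (w2 / w1))" by (simp add: complex_eq_iff)
    then have "of_real (Re (w2 / w1)) * w1 + of_real (-1) * w2 = 0" using w1 by (metis add.right_inverse mult_minus1 nonzero_eq_divide_eq of_real_1 of_real_minus)
    from ind[OF this] show False by simp
  qed
qed

text \<open>Both coordinates of a lattice point are O(|l|), so the summand is at most a constant
  times \<open>((1 + |m|) * (1 + |n|)) powr (-3/2)\<close>, the general term of a product of two
  convergent series.\<close>

lemma lattice_summable:
  assumes "is_lattice L"
  shows "(\<lambda>l. 1 / norm l ^ 3) summable_on L"
proof -
  obtain w1 w2 where ind: "\<And>a b :: real. of_real a * w1 + of_real b * w2 = 0 \<Longrightarrow> a = 0 \<and> b = 0"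
    and L: "L = {of_int m * w1 + of_int n * w2 | m n :: int. True}"
    using assms unfolding is_lattice_def by blast
  have w1: "w1 \<noteq> 0" and q0: "Im (w2 / w1) \<noteq> 0"
    by (rule independent_imp_Im_neq_0[OF ind], assumption)+
  define q where "q = w2 / w1"
  define h where "h = (\<lambda>(m::int, n::int). of_int m * w1 + of_int n * w2)"
  have inj: "inj h"
  proof (rule injI, clarify)
    fix m n m' n' :: int
    assume "h (m, n) = h (m', n')"
    then have "of_real (of_int (m - m')) * w1 + of_real (of_int (n - n')) * w2 = 0"
      by (simp add: h_def algebra_simps)
    from ind[OF this] show "m = m' \<and> n = n'" by simp
  qed
  have Lh: "L = range h" by (force simp: L h_def)
  \<comment> \<open>\<open>k1\<close> comes from the imaginary part of
    \<open>l / w1 = m + n q\<close>, which is \<open>n * Im q\<close>; \<open>k2\<close> then comes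
    from the triangle inequality.\<close>
  define k1 where "k1 = 1 / (norm w1 * \<bar>Im q\<bar>)"
  define k2 where "k2 = 1 / norm w1 + k1 * norm q"
  have k: "k1 > 0" "k2 > 0" using w1 q0 by (auto simp: k1_def k2_def q_def intro!: add_pos_nonneg)
  have coord: "\<bar>of_int n\<bar> \<le> k1 * norm (h (m, n))" "\<bar>of_int m\<bar> \<le> k2 * norm (h (m, n))" for m n
  proof -
    have hq: "h (m, n) = w1 * (of_int m + of_int n * q)" using w1 by (simp add: h_def q_def field_simps)
    have "\<bar>of_int n\<bar> * \<bar>Im q\<bar> = \<bar>Im (of_int m + of_int n * q)\<bar>" by (simp add: abs_mult)
    also have "\<dots> \<le> norm (of_int m + of_int n * q)" by (rule abs_Im_le_cmod)
    also have "\<dots> = norm (h (m, n)) / norm w1" using w1 by (simp add: hq norm_mult)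
    finally show n: "\<bar>of_int n\<bar> \<le> k1 * norm (h (m, n))"
      using w1 q0 by (simp add: k1_def q_def field_simps)
    have "\<bar>of_int m\<bar> = norm ((of_int m + of_int n * q) - of_int n * q)" by simp
    also have "\<dots> \<le> norm (of_int m + of_int n * q) + norm (of_int n * q)" by (rule norm_triangle_ineq4)
    also have "norm (of_int n * q) \<le> k1 * norm (h (m, n)) * norm q"
      using n by (simp add: norm_mult mult_right_mono)
    also have "norm (of_int m + of_int n * q) = norm (h (m, n)) / norm w1" using w1 by (simp add: hq norm_mult)
    finally show "\<bar>of_int m\<bar> \<le> k2 * norm (h (m, n))" by (simp add: k2_def algebra_simps)
  qed
  \<comment> \<open>A nonzero lattice point has 1 \<le> |m| + |n| \<le> (k1 + k2) |l|; the factor 2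
    absorbs the 1 in \<open>1 + |m|\<close> and \<open>1 + |n|\<close>.\<close>
  define K where "K = 2 * (k1 + k2)"
  have K: "K > 0" using k by (simp add: K_def)
  have bound: "1 / norm (h (m, n)) ^ 3 \<le> K ^ 3 * ((1 + \<bar>of_int m\<bar>) * (1 + \<bar>of_int n\<bar>)) powr (-3/2)" for m n
  proof (cases "h (m, n) = 0")
    \<comment> \<open>At the origin the left side is \<open>1 / 0 = 0\<close>.\<close>
    case True
    then show ?thesis using K by simp
  next
    case False
    define N where "N = norm (h (m, n))"
    have N: "N > 0" using False by (simp add: N_def)
    have m0: "m \<noteq> 0 \<or> n \<noteq> 0" using False by (auto simp: h_def)
    have c: "\<bar>of_int n\<bar> \<le> k1 * N" "\<bar>of_int m\<bar> \<le> k2 * N" using coord by (simp_all add: N_def)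
    have "1 \<le> \<bar>of_int m :: real\<bar> + \<bar>of_int n\<bar>"
    proof -
      have "1 \<le> \<bar>m\<bar> + \<bar>n\<bar>" using m0 by auto
      then have "of_int 1 \<le> (of_int (\<bar>m\<bar> + \<bar>n\<bar>) :: real)" by (simp only: of_int_le_iff)
      then show ?thesis by simp
    qed
    then have one: "1 \<le> k1 * N + k2 * N" using c by linarith
    have "1 + \<bar>of_int m\<bar> \<le> K * N" "1 + \<bar>of_int n\<bar> \<le> K * N"
      using one c mult_pos_pos[OF k(1) N] mult_pos_pos[OF k(2) N] by (simp_all add: K_def algebra_simps)
    then have "(1 + \<bar>of_int m\<bar>) * (1 + \<bar>of_int n\<bar>) \<le> (K * N) * (K * N)"
      by (intro mult_mono) auto
    then have "((K * N) * (K * N)) powr (-3/2) \<le> ((1 + \<bar>of_int m\<bar>) * (1 + \<bar>of_int n\<bar>)) powr (-3/2)"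
      by (intro powr_mono2') (auto intro!: add_pos_nonneg mult_pos_pos)
    moreover have "((K * N) * (K * N)) powr (-3/2) = 1 / (K * N) ^ 3"
    proof -
      have "K * N > 0" using K N by simp
      then have "((K * N) * (K * N)) powr (-3/2) = ((K * N) powr 2) powr (-3/2)"
        by (simp add: powr_numeral power2_eq_square)
      also have "\<dots> = (K * N) powr (- 3)" by (simp add: powr_powr)
      also have "\<dots> = 1 / (K * N) ^ 3" using \<open>K * N > 0\<close> by (simp add: powr_minus powr_numeral divide_inverse)
      finally show ?thesis .
    qed
    ultimately have "K ^ 3 * (1 / (K * N) ^ 3) \<le> K ^ 3 * ((1 + \<bar>of_int m\<bar>) * (1 + \<bar>of_int n\<bar>)) powr (-3/2)"
      using K by (intro mult_left_mono) auto
    moreover have "K ^ 3 * (1 / (K * N) ^ 3) = 1 / N ^ 3" using K N by (simp add: power_mult_distrib)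
    ultimately show ?thesis by (simp add: N_def)
  qed
  have "(\<lambda>p. 1 / norm (h p) ^ 3) summable_on UNIV"
  proof (rule summable_on_comparison_test)
    show "(\<lambda>p. K ^ 3 * (\<lambda>(m::int, n::int). ((1 + \<bar>of_int m\<bar>) * (1 + \<bar>of_int n\<bar>)) powr (-3/2)) p) summable_on UNIV"
      using summable_on_cmult_right[OF summable_on_int_pairs_powr[of "-3/2"]] by simp
    show "1 / norm (h p) ^ 3 \<le> K ^ 3 * (\<lambda>(m::int, n::int). ((1 + \<bar>of_int m\<bar>) * (1 + \<bar>of_int n\<bar>)) powr (-3/2)) p" for p
      using bound[of "fst p" "snd p"] by (simp add: case_prod_beta)
  qed simp
  then show ?thesis
    unfolding Lh by (subst summable_on_reindex[OF inj]) (simp add: o_def)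
qed

text \<open>Periods move every point into the fundamental parallelogram, which lies in the closed
  disc of radius \<open>norm w1 + norm w2\<close>.\<close>

lemma lattice_periodic_entire_bounded:
  assumes "is_lattice L" and h: "h holomorphic_on UNIV" and per: "\<And>z u. u \<in> L \<Longrightarrow> h (z + u) = h z"
  shows "bounded (range h)"
proof -
  obtain w1 w2 where ind: "\<And>a b :: real. of_real a * w1 + of_real b * w2 = 0 \<Longrightarrow> a = 0 \<and> b = 0"
    and L: "L = {of_int m * w1 + of_int n * w2 | m n :: int. True}"
    using assms unfolding is_lattice_def by blast
  define q where "q = w2 / w1"
  have w1: "w1 \<noteq> 0" by (rule independent_imp_Im_neq_0(1)[OF ind])
  have q0: "Im q \<noteq> 0" unfolding q_def by (rule independent_imp_Im_neq_0(2)[OF ind])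
  obtain N where N: "\<And>z. norm z \<le> norm w1 + norm w2 \<Longrightarrow> norm (h z) \<le> N"
    by (rule entire_bounded_on_cball[OF h]) (rule that)
  have "norm (h z) \<le> N" for z
  proof -
    define t s where "t = Im (z / w1) / Im q" and "s = Re (z / w1) - t * Re q"
    have "z / w1 = of_real s + of_real t * q"
      using q0 by (intro complex_eqI) (simp_all add: t_def s_def)
    then have z: "z = of_real s * w1 + of_real t * w2" using w1 by (simp add: q_def field_simps)
    define y where "y = of_real (frac s) * w1 + of_real (frac t) * w2"
    have "y + (of_int \<lfloor>s\<rfloor> * w1 + of_int \<lfloor>t\<rfloor> * w2) = z"
      unfolding y_def z frac_def by (simp add: algebra_simps)
    then have "h z = h y" using per[of _ y] L by (metis (mono_tags, lifting) mem_Collect_eq)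
    moreover have "norm (of_real (frac r) * w) \<le> 1 * norm w" for r and w :: complex
      unfolding norm_mult by (rule mult_right_mono) (use frac_lt_1[of r] in auto)
    then have "norm y \<le> 1 * norm w1 + 1 * norm w2"
      unfolding y_def by (intro norm_triangle_le add_mono)
    ultimately show ?thesis using N by simp
  qed
  then show ?thesis unfolding bounded_iff by blast
qed

section \<open>The three-term equation\<close>

locale three_term_equation =
  fixes f :: "complex \<Rightarrow> complex"
  assumes hol: "f holomorphic_on UNIV"
    and odd: "f (- z) = - f z"
    and nonzero: "\<exists>z. f z \<noteq> 0"
    and three_term: "f (a + b) * f (a - b) * f (c + d) * f (c - d)
      = f (a + d) * f (a - d) * f (c + b) * f (c - b) + f (a + c) * f (a - c) * f (b + d) * f (b - d)"
begin

lemma f_0: "f 0 = 0"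
  using odd[of 0] by simp

lemma f_has_deriv: "(f has_field_derivative deriv f z) (at z)"
  by (rule entire_has_deriv[OF hol])

lemma not_constant: "\<not> f constant_on UNIV"
  using nonzero f_0 by (metis UNIV_I constant_on_def)

text \<open>If \<open>f\<close> vanishes to order \<open>n\<close> at \<open>0\<close>, the leading terms of the equation at
  \<open>a\<^sup>2 = 3\<close>, \<open>b = 1\<close>, \<open>c\<^sup>2 = 2\<close>, \<open>d = 0\<close> give \<open>4 ^ n = 3 ^ n + 1\<close>.\<close>
lemma deriv_0: "deriv f 0 \<noteq> 0"
proof -
  obtain g r n where n: "0 < n" and r: "0 < r" and g: "g holomorphic_on ball 0 r"
    and fg: "\<And>w. w \<in> ball 0 r \<Longrightarrow> f w = (w - 0) ^ n * g w"
    and g0: "\<And>w. w \<in> ball 0 r \<Longrightarrow> g w \<noteq> 0"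
    using holomorphic_factor_zero_nonconstant[OF hol open_UNIV connected_UNIV UNIV_I f_0 not_constant]
    by (metis (no_types, lifting))
  have cg: "(g \<longlongrightarrow> g 0) (at 0)"
    using holomorphic_on_imp_continuous_on[OF g] r
    by (simp add: continuous_on_eq_continuous_at isCont_def)
  have scaled: "((\<lambda>t. g (t * k)) \<longlongrightarrow> g 0) (at 0)" for k
  proof -
    have "isCont g 0" using cg by (simp add: isCont_def)
    then have "isCont (\<lambda>t. g (t * k)) 0"
      by (intro isCont_o2[where f = "\<lambda>t. t * k" and g = g]) (simp_all add: continuous_intros)
    then show ?thesis by (simp add: isCont_def)
  qed
  define A B C :: complex where "A = of_real (sqrt 3)" and "B = 1" and "C = of_real (sqrt 2)"
  have sq: "A * A = 3" "B * B = 1" "C * C = 2"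
    by (simp_all add: A_def B_def C_def flip: of_real_mult)
  \<comment> \<open>\<open>\<Phi> t\<close> is the difference of the two sides at
    \<open>t A\<close>, \<open>t B\<close>, \<open>t C\<close>, \<open>0\<close>, divided by
    \<open>t ^ (4 n)\<close>. It vanishes for small nonzero \<open>t\<close>, so its limit at 0 is
    0.\<close>
  define \<Phi> where "\<Phi> t = ((A + B) * (A - B) * C * C) ^ n * (g (t * (A + B)) * g (t * (A - B)) * g (t * C) * g (t * C))
     - (A * A * (C + B) * (C - B)) ^ n * (g (t * A) * g (t * A) * g (t * (C + B)) * g (t * (C - B)))
     - ((A + C) * (A - C) * B * B) ^ n * (g (t * (A + C)) * g (t * (A - C)) * g (t * B) * g (t * B))" for t
  define m where "m = Max (norm ` {A + B, A - B, C, A, C + B, C - B, A + C, A - C, B}) + 1"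
  have m: "norm k < m" if "k \<in> {A + B, A - B, C, A, C + B, C - B, A + C, A - C, B}" for k
  proof -
    have "norm k \<le> Max (norm ` {A + B, A - B, C, A, C + B, C - B, A + C, A - C, B})"
      using that by (intro Max_ge) auto
    then show ?thesis unfolding m_def by linarith
  qed
  have "norm A < m" by (rule m) simp
  then have m0: "m > 0" using norm_ge_zero[of A] by linarith
  have zero: "\<Phi> t = 0" if t: "t \<noteq> 0" "norm t < r / m" for t
  proof -
    have ft: "f (t * k) = t ^ n * k ^ n * g (t * k)"
      if "k \<in> {A + B, A - B, C, A, C + B, C - B, A + C, A - C, B}" for k
    proof -
      have "norm (t * k) \<le> norm t * m" using m[OF that] by (simp add: norm_mult mult_left_mono)
      also have "\<dots> < r" using t m0 by (simp add: pos_less_divide_eq)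
      finally show ?thesis using fg[of "t * k"] by (simp add: power_mult_distrib)
    qed
    have "f (t * (A + B)) * f (t * (A - B)) * f (t * C) * f (t * C)
      = f (t * A) * f (t * A) * f (t * (C + B)) * f (t * (C - B)) + f (t * (A + C)) * f (t * (A - C)) * f (t * B) * f (t * B)"
      using three_term[of "t * A" "t * B" "t * C" 0] by (simp add: algebra_simps)
    then have "(t ^ n * (A + B) ^ n * g (t * (A + B))) * (t ^ n * (A - B) ^ n * g (t * (A - B)))
        * (t ^ n * C ^ n * g (t * C)) * (t ^ n * C ^ n * g (t * C))
      = (t ^ n * A ^ n * g (t * A)) * (t ^ n * A ^ n * g (t * A))
        * (t ^ n * (C + B) ^ n * g (t * (C + B))) * (t ^ n * (C - B) ^ n * g (t * (C - B)))
      + (t ^ n * (A + C) ^ n * g (t * (A + C))) * (t ^ n * (A - C) ^ n * g (t * (A - C)))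
        * (t ^ n * B ^ n * g (t * B)) * (t ^ n * B ^ n * g (t * B))"
      by (simp only: ft insert_iff simp_thms)
    then have "t ^ n * t ^ n * t ^ n * t ^ n * \<Phi> t = 0"
      unfolding \<Phi>_def power_mult_distrib by (simp add: algebra_simps)
    with t show ?thesis by simp
  qed
  have "(\<Phi> \<longlongrightarrow> ((A + B) * (A - B) * C * C) ^ n * (g 0 * g 0 * g 0 * g 0)
     - (A * A * (C + B) * (C - B)) ^ n * (g 0 * g 0 * g 0 * g 0)
     - ((A + C) * (A - C) * B * B) ^ n * (g 0 * g 0 * g 0 * g 0)) (at 0)"
    unfolding \<Phi>_def by (intro tendsto_intros scaled)
  moreover have "(\<Phi> \<longlongrightarrow> 0) (at 0)"
  proof (rule tendsto_eventually)
    show "\<forall>\<^sub>F t in at 0. \<Phi> t = 0"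
      unfolding eventually_at using zero r m0 by (intro exI[of _ "r / m"]) auto
  qed
  ultimately have lead: "((A + B) * (A - B) * C * C) ^ n * (g 0 * g 0 * g 0 * g 0)
     - (A * A * (C + B) * (C - B)) ^ n * (g 0 * g 0 * g 0 * g 0)
     - ((A + C) * (A - C) * B * B) ^ n * (g 0 * g 0 * g 0 * g 0) = 0"
    by (intro tendsto_unique[OF _ _ \<open>(\<Phi> \<longlongrightarrow> 0) (at 0)\<close>]) auto
  have val: "(A + B) * (A - B) * C * C = 4" "A * A * (C + B) * (C - B) = 3" "(A + C) * (A - C) * B * B = 1"
  proof -
    have "(A + B) * (A - B) * C * C = (A * A - B * B) * (C * C)"
      "A * A * (C + B) * (C - B) = A * A * (C * C - B * B)"
      "(A + C) * (A - C) * B * B = (A * A - C * C) * (B * B)"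
      by (simp_all add: algebra_simps)
    then show "(A + B) * (A - B) * C * C = 4" "A * A * (C + B) * (C - B) = 3" "(A + C) * (A - C) * B * B = 1"
      by (simp_all add: sq)
  qed
  have "(4 ^ n - 3 ^ n - 1) * (g 0 * g 0 * g 0 * g 0) = 0"
    using lead unfolding val by (simp add: algebra_simps)
  moreover have "g 0 \<noteq> 0" using g0 r by simp
  ultimately have "(4::complex) ^ n - 3 ^ n - 1 = 0" by (metis mult_eq_0_iff)
  then have "(4::complex) ^ n = 3 ^ n + 1" by (simp add: algebra_simps)
  then have "of_nat (4 ^ n) = (of_nat (3 ^ n + 1) :: complex)" by simp
  then have n4: "(4::nat) ^ n = 3 ^ n + 1" using of_nat_eq_iff by blast
  have "n < 2"
  proof (rule ccontr)
    assume "\<not> n < 2"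
    then have "2 \<le> n" by simp
    then have "(3::nat) ^ n + 1 < 4 ^ n" by (induction n rule: dec_induct) auto
    with n4 show False by simp
  qed
  with n have [simp]: "n = 1" by simp
  have "((\<lambda>w. f w / (w - 0)) \<longlongrightarrow> g 0) (at 0)"
  proof (rule Lim_transform_eventually[OF cg])
    show "\<forall>\<^sub>F w in at 0. g w = f w / (w - 0)"
      unfolding eventually_at using fg r by (intro exI[of _ r]) auto
  qed
  then have "deriv f 0 = g 0"
    using simple_zero_quotient[OF hol f_0] tendsto_unique trivial_limit_at by blast
  with \<open>g 0 \<noteq> 0\<close> show ?thesis by simp
qed

section \<open>The group of zeros and translation by a zero\<close>

lemma zero_shift:
  assumes u: "f u = 0"
  shows "f (a + u) * f (a - u) * (f b)\<^sup>2 = f (b + u) * f (b - u) * (f a)\<^sup>2"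
  using three_term[of a b u 0] odd[of "b - u"] u by (simp add: power2_eq_square algebra_simps)

text \<open>By \<open>zero_shift\<close>, the case \<open>c = u\<close>, \<open>d = 0\<close> of the
  equation, the quotient of \<open>f (a + u) * f (a - u)\<close> by \<open>(f a)^2\<close> is
  constant. It is nonzero because a product of two translates of \<open>f\<close> does not vanish
  identically.\<close>

lemma zero_shift':
  assumes u: "f u = 0"
  obtains K where "K \<noteq> 0" "\<And>a. f (a + u) * f (a - u) = K * (f a)\<^sup>2"
proof -
  obtain b where b: "f b \<noteq> 0" using nonzero by blast
  define K where "K = f (b + u) * f (b - u) / (f b)\<^sup>2"
  have K: "f (a + u) * f (a - u) = K * (f a)\<^sup>2" for a
    using zero_shift[OF u, of a b] b by (simp add: K_def field_simps)
  have "K \<noteq> 0"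
  proof
    assume K0: "K = 0"
    have hu: "(\<lambda>a. f (a + u)) holomorphic_on UNIV" "(\<lambda>a. f (a - u)) holomorphic_on UNIV"
      by (intro holomorphic_on_compose_gen[OF _ hol, unfolded o_def] holomorphic_intros; simp)+
    have "f (a + u) = 0" for a
      by (rule entire_cancel[OF hu(1) holomorphic_on_const hu(2), of "b + u"])
         (use K K0 b in auto)
    from this[of "b - u"] b show False by simp
  qed
  with K show thesis using that by blast
qed

text \<open>Dividing \<open>zero_shift'\<close> by \<open>a^2\<close> and letting \<open>a\<close>
  tend to 0 gives \<open>f' u * f' (- u) = K * (f' 0)^2\<close>, which is nonzero by
  \<open>deriv_0\<close>.\<close>

lemma deriv_zero:
  assumes u: "f u = 0"
  shows "deriv f u \<noteq> 0"
proof -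
  obtain K where K: "K \<noteq> 0" "\<And>a. f (a + u) * f (a - u) = K * (f a)\<^sup>2"
    using zero_shift'[OF u] by metis
  have q: "((\<lambda>a. f (a + u) / a) \<longlongrightarrow> deriv f u) (at 0)"
    using f_has_deriv[of u] u by (simp add: DERIV_def add.commute)
  have u': "f (- u) = 0" using u odd by simp
  have q': "((\<lambda>a. f (a - u) / a) \<longlongrightarrow> deriv f (- u)) (at 0)"
    using f_has_deriv[of "- u"] u' by (simp add: DERIV_def)
  have q0: "((\<lambda>a. f a / a) \<longlongrightarrow> deriv f 0) (at 0)"
    using f_has_deriv[of 0] f_0 by (simp add: DERIV_def)
  have "((\<lambda>a. (f (a + u) / a) * (f (a - u) / a)) \<longlongrightarrow> deriv f u * deriv f (- u)) (at 0)"
    by (intro tendsto_intros q q')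
  moreover have "((\<lambda>a. (f (a + u) / a) * (f (a - u) / a)) \<longlongrightarrow> K * (deriv f 0)\<^sup>2) (at 0)"
  proof -
    have "((\<lambda>a. K * (f a / a)\<^sup>2) \<longlongrightarrow> K * (deriv f 0)\<^sup>2) (at 0)" by (intro tendsto_intros q0)
    moreover have "(\<lambda>a. K * (f a / a)\<^sup>2) = (\<lambda>a. (f (a + u) / a) * (f (a - u) / a))"
      using K(2) by (simp add: power2_eq_square)
    ultimately show ?thesis by simp
  qed
  ultimately have "deriv f u * deriv f (- u) = K * (deriv f 0)\<^sup>2"
    using tendsto_unique trivial_limit_at by blast
  with K deriv_0 show ?thesis by auto
qed

text \<open>At \<open>a = v\<close> the right side of \<open>zero_shift'\<close> vanishes together
  with its derivative. Since zeros of \<open>f\<close> are simple, both factors on the left must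
  vanish.\<close>

lemma zero_add_diff:
  assumes u: "f u = 0" and v: "f v = 0"
  shows "f (v + u) = 0" "f (v - u) = 0"
proof -
  obtain K where K: "\<And>a. f (a + u) * f (a - u) = K * (f a)\<^sup>2"
    using zero_shift'[OF u] by metis
  have 0: "f (v + u) * f (v - u) = 0" unfolding K v by simp
  have "((\<lambda>a. f (a + u) * f (a - u)) has_field_derivative
      deriv f (v + u) * f (v - u) + deriv f (v - u) * f (v + u)) (at v)"
    by (rule derivative_eq_intros DERIV_chain2[OF f_has_deriv] | simp)+
  moreover have "((\<lambda>a. K * (f a)\<^sup>2) has_field_derivative 0) (at v)"
    by (rule derivative_eq_intros f_has_deriv | simp add: v)+
  ultimately have "deriv f (v + u) * f (v - u) + deriv f (v - u) * f (v + u) = 0"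
    unfolding K using DERIV_unique by blast
  with 0 deriv_zero show "f (v + u) = 0" "f (v - u) = 0" by auto
qed

text \<open>Parameters with \<open>c + d = u\<close> make the left side of the three-term equation
  vanish. The remaining two products say that the multiplier
  \<open>f (x + u) * f (y + u) / (f x * f y)\<close> depends only on \<open>x + y\<close>.\<close>

lemma zero_translate_ratio:
  assumes u: "f u = 0" and s: "x + y = x' + y'"
  shows "f (x + u) * f (y + u) * f x' * f y' = f (x' + u) * f (y' + u) * f x * f y"
proof -
  \<comment> \<open>\<open>d\<close> depends only on the common sum, so it serves both pairs;
    \<open>b\<close> and \<open>a\<close> are their half-differences.\<close>
  define d b a where "d = - (x + y) / 2" and "b = (x - y) / 2" and "a = (x' - y') / 2"
  have x: "x = b - d" "y = - (b + d)" by (simp_all add: d_def b_def field_simps)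
  have x': "x' = a - d" "y' = - (a + d)" using s by (simp_all add: d_def a_def field_simps)
  have e: "f (u - d + b) = f (x + u)" "f (u - d - b) = f (y + u)" "f (a + (u - d)) = f (x' + u)"
    "f (a - (u - d)) = - f (y' + u)" "f (a + d) = - f y'" "f (b + d) = - f y" "f (a - d) = f x'" "f (b - d) = f x"
    unfolding odd[symmetric] by (simp_all add: x x' algebra_simps)
  show ?thesis
    using three_term[of a b "u - d" d] u unfolding e by (simp add: algebra_simps)
qed

text \<open>The points \<open>x + t\<close>, \<open>y - t\<close> keep their sum, so
  \<open>zero_translate_ratio\<close> may be differentiated in \<open>t\<close> at 0.\<close>

lemma log_deriv_shift:
  assumes u: "f u = 0" and x: "f x \<noteq> 0" and y: "f y \<noteq> 0"
  shows "deriv f (x + u) / f (x + u) - deriv f x / f x = deriv f (y + u) / f (y + u) - deriv f y / f y"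
proof -
  have xu: "f (x + u) \<noteq> 0" "f (y + u) \<noteq> 0"
    using zero_add_diff(2)[OF u, of "x + u"] zero_add_diff(2)[OF u, of "y + u"] x y by auto
  have eq: "f (x + t + u) * f (y - t + u) * (f x * f y) - f (x + u) * f (y + u) * (f (x + t) * f (y - t)) = 0" for t
    using zero_translate_ratio[OF u, of "x + t" "y - t" x y] by (simp add: algebra_simps)
  have "((\<lambda>t. f (x + t + u) * f (y - t + u) * (f x * f y) - f (x + u) * f (y + u) * (f (x + t) * f (y - t)))
     has_field_derivative (deriv f (x + u) * f (y + u) - deriv f (y + u) * f (x + u)) * (f x * f y)
       - f (x + u) * f (y + u) * (deriv f x * f y - deriv f y * f x)) (at 0)"
    by (rule derivative_eq_intros DERIV_chain2[OF f_has_deriv] | simp)+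
  then have "(deriv f (x + u) * f (y + u) - deriv f (y + u) * f (x + u)) * (f x * f y)
       - f (x + u) * f (y + u) * (deriv f x * f y - deriv f y * f x) = 0"
    unfolding eq using DERIV_unique DERIV_const by blast
  with x y xu show ?thesis by (simp add: field_simps)
qed

section \<open>The quotient \<phi> and its values far from the zeros\<close>

definition \<phi> :: "complex \<Rightarrow> complex \<Rightarrow> complex" where
  "\<phi> c a = f (a + c) * f (a - c) / ((f a)\<^sup>2 * (f c)\<^sup>2)"

text \<open>This is the case \<open>d = 0\<close> of the three-term equation after division by
  squares. For the sigma function, \<open>\<phi> c a\<close> is wp(c) - wp(a) with the Weierstrass
  elliptic function wp, which explains why \<open>c\<close> drops out.\<close>

lemma \<phi>_diff:
  assumes "f a \<noteq> 0" "f b \<noteq> 0" "f c \<noteq> 0"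
  shows "\<phi> c a - \<phi> c b = f (a + b) * f (a - b) / ((f a)\<^sup>2 * (f b)\<^sup>2)"
proof -
  have "f (a + b) * f (a - b) * (f c)\<^sup>2 = f (a + c) * f (a - c) * (f b)\<^sup>2 - f (b + c) * f (b - c) * (f a)\<^sup>2"
    using three_term[of a b c 0] odd[of "b - c"] by (simp add: power2_eq_square algebra_simps)
  moreover have "\<phi> c a - \<phi> c b
      = (f (a + c) * f (a - c) * (f b)\<^sup>2 - f (b + c) * f (b - c) * (f a)\<^sup>2) / ((f a)\<^sup>2 * (f b)\<^sup>2 * (f c)\<^sup>2)"
    using assms by (simp add: \<phi>_def diff_divide_distrib)
  ultimately have "\<phi> c a - \<phi> c b = f (a + b) * f (a - b) * (f c)\<^sup>2 / ((f a)\<^sup>2 * (f b)\<^sup>2 * (f c)\<^sup>2)"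
    by metis
  then show ?thesis using assms by simp
qed

text \<open>By \<open>\<phi>_diff\<close>, \<open>\<phi> c\<close> identifies only points congruent modulo the zeros of \<open>f\<close> up to sign;
  the values close to \<open>\<phi> c c = 0\<close> are already taken near \<open>c\<close>.\<close>
lemma \<phi>_lower_bound:
  assumes \<delta>: "\<And>z. z \<noteq> 0 \<Longrightarrow> norm z < 3 * \<delta> \<Longrightarrow> f z \<noteq> 0" and c: "c \<noteq> 0" "norm c < \<delta>"
  obtains r where "r > 0"
    "\<And>z. f z \<noteq> 0 \<Longrightarrow> (\<And>l. f l = 0 \<Longrightarrow> 2 * \<delta> \<le> norm (z - l)) \<Longrightarrow> r \<le> norm (\<phi> c z)"
proof -
  \<comment> \<open>This disc has 0 on its boundary and stays within \<open>2 * \<delta>\<close> of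
    0, so it contains no zero of \<open>f\<close>.\<close>
  define B where "B = ball c (norm c)"
  have B: "b \<noteq> 0 \<and> norm b < 2 * \<delta>" if "b \<in> B" for b
  proof -
    have "norm (b - c) < norm c" using that by (simp add: B_def dist_norm norm_minus_commute)
    moreover have "norm b \<le> norm (b - c) + norm c" using norm_triangle_ineq[of "b - c" c] by simp
    ultimately show ?thesis using c by auto
  qed
  have dpos: "\<delta> > 0" using c norm_ge_zero[of c] by linarith
  have Bf: "f b \<noteq> 0" if "b \<in> B" for b
    by (rule \<delta>) (use B[OF that] dpos in auto)
  have fc: "f c \<noteq> 0" by (rule \<delta>) (use c dpos in auto)
  have hol_\<phi>: "\<phi> c holomorphic_on B"
  proof -
    have "(\<lambda>a. f (a + c)) holomorphic_on B" "(\<lambda>a. f (a - c)) holomorphic_on B"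
      by (intro holomorphic_on_compose_gen[OF _ hol, unfolded o_def] holomorphic_intros; simp)+
    then show ?thesis unfolding \<phi>_def using Bf fc
      by (intro holomorphic_intros holomorphic_on_subset[OF hol]) auto
  qed
  have \<phi>0: "\<phi> c c = 0" by (simp add: \<phi>_def f_0)
  have cB: "c \<in> B" using c by (simp add: B_def)
  have "\<not> \<phi> c constant_on B"
  proof
    assume "\<phi> c constant_on B"
    \<comment> \<open>At \<open>3/2 * c\<close> the numerator of \<open>\<phi> c\<close> is
      \<open>f (5/2 * c) * f (1/2 * c)\<close>; both arguments are nonzero and of norm below
      \<open>3 * \<delta>\<close>.\<close>
    moreover have aB: "3/2 * c \<in> B" using c by (simp add: B_def dist_norm norm_mult flip: left_diff_distrib')
    ultimately have "\<phi> c (3/2 * c) = 0" using \<phi>0 cB unfolding constant_on_def by metis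
    then have "f (3/2 * c + c) = 0 \<or> f (3/2 * c - c) = 0" using Bf[OF aB] fc by (simp add: \<phi>_def)
    moreover have "f (5/2 * c) \<noteq> 0" "f (1/2 * c) \<noteq> 0"
      by (rule \<delta>; use c dpos in \<open>simp add: norm_mult\<close>)+
    ultimately show False by (simp flip: distrib_left add: algebra_simps)
  qed
  then have "open (\<phi> c ` B)"
    using open_mapping_thm[OF hol_\<phi>, of B] by (simp add: B_def)
  moreover have "0 \<in> \<phi> c ` B" using \<phi>0 cB by force
  ultimately obtain r where r: "r > 0" "ball 0 r \<subseteq> \<phi> c ` B" using open_contains_ball by blast
  have "r \<le> norm (\<phi> c z)" if z: "f z \<noteq> 0" "\<And>l. f l = 0 \<Longrightarrow> 2 * \<delta> \<le> norm (z - l)" for z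
  proof (rule ccontr)
    assume "\<not> r \<le> norm (\<phi> c z)"
    then have "\<phi> c z \<in> ball 0 r" by simp
    \<comment> \<open>A value inside the disc of radius \<open>r\<close> is also taken at some
      \<open>b\<close> in \<open>B\<close>; by \<open>\<phi>_diff\<close> then \<open>z + b\<close>
      or \<open>z - b\<close> is a zero closer to \<open>z\<close> than
      \<open>2 * \<delta>\<close>.\<close>
    then obtain b where b: "b \<in> B" "\<phi> c z = \<phi> c b" using r by blast
    then have "f (z + b) * f (z - b) = 0"
      using \<phi>_diff[OF z(1) Bf[OF b(1)] fc] z(1) Bf[OF b(1)] by simp
    then show False
      using z(2)[of "z + b"] z(2)[of "z - b"] B[OF b(1)] by auto
  qed
  with r(1) show thesis using that by blast
qed

section \<open>Trivial and cyclic groups of zeros\<close>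

lemma zero_free_radius:
  obtains \<delta> where "\<delta> > 0" "\<And>z. z \<noteq> 0 \<Longrightarrow> norm z < 3 * \<delta> \<Longrightarrow> f z \<noteq> 0"
proof -
  obtain z0 where "f z0 \<noteq> 0" using nonzero by blast
  then obtain e where "e > 0" "ball 0 e \<inter> {z. f z = 0} \<subseteq> {0}"
    using entire_zeros_isolated[OF hol] by blast
  then show thesis by (intro that[of "e / 3"]) auto
qed

text \<open>Dividing \<open>f (z + c) * f (z - c)\<close> by \<open>(f z)^2\<close> turns the
  exponent \<open>g\<close> into a second difference. Denominators are cleared so that zeros are
  included.\<close>

lemma second_difference_eq:
  assumes eq: "\<And>z. f z = S z * exp (g z)"
  shows "exp (2 * g z - g (z + c) - g (z - c)) * (S z)\<^sup>2 * (f (z + c) * f (z - c))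
    = (f z)\<^sup>2 * (S (z + c) * S (z - c))"
proof -
  have "exp (2 * g z - g (z + c) - g (z - c)) * exp (g (z + c)) * exp (g (z - c)) = (exp (g z))\<^sup>2"
    by (simp add: power2_eq_square flip: exp_add)
  then have "(exp (2 * g z - g (z + c) - g (z - c)) * exp (g (z + c)) * exp (g (z - c))) * ((S z)\<^sup>2 * S (z + c) * S (z - c))
    = (exp (g z))\<^sup>2 * ((S z)\<^sup>2 * S (z + c) * S (z - c))" by simp
  then show ?thesis unfolding eq by (simp add: power_mult_distrib mult_ac)
qed

text \<open>The exponential is the quotient of \<open>S (z + c) * S (z - c) / (S z)^2\<close> by
  \<open>\<phi> c z * (f c)^2\<close>; the first is bounded above and \<open>\<phi>\<close> is
  bounded below.\<close>

lemma second_difference_bound: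
  assumes eq: "\<And>z. f z = S z * exp (g z)" and z: "f z \<noteq> 0" and c: "f c \<noteq> 0"
    and r: "r > 0" "r \<le> norm (\<phi> c z)"
    and b: "norm (S (z + c) * S (z - c)) \<le> b * (norm (S z))\<^sup>2"
  shows "norm (exp (2 * g z - g (z + c) - g (z - c))) \<le> b / (r * (norm (f c))\<^sup>2)"
proof -
  let ?E = "exp (2 * g z - g (z + c) - g (z - c))"
  have S: "S z \<noteq> 0" using eq z by auto
  have "f (z + c) * f (z - c) = \<phi> c z * (f z)\<^sup>2 * (f c)\<^sup>2" using z c by (simp add: \<phi>_def)
  then have "?E * (S z)\<^sup>2 * (\<phi> c z * (f z)\<^sup>2 * (f c)\<^sup>2) = (f z)\<^sup>2 * (S (z + c) * S (z - c))"
    using second_difference_eq[OF eq, of z c] by simp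
  then have "(?E * \<phi> c z * (f c)\<^sup>2 * (S z)\<^sup>2) * (f z)\<^sup>2 = (S (z + c) * S (z - c)) * (f z)\<^sup>2"
    by (simp add: mult_ac)
  then have "?E * \<phi> c z * (f c)\<^sup>2 * (S z)\<^sup>2 = S (z + c) * S (z - c)" using z by simp
  then have "norm ?E * norm (\<phi> c z) * (norm (f c))\<^sup>2 * (norm (S z))\<^sup>2 \<le> b * (norm (S z))\<^sup>2"
    using b by (metis norm_mult norm_power)
  then have "norm ?E * norm (\<phi> c z) * (norm (f c))\<^sup>2 \<le> b" using S by simp
  moreover have "norm ?E * r * (norm (f c))\<^sup>2 \<le> norm ?E * norm (\<phi> c z) * (norm (f c))\<^sup>2"
    using r by (intro mult_right_mono mult_left_mono) auto
  ultimately have "norm ?E * (r * (norm (f c))\<^sup>2) \<le> b" by (simp add: mult_ac)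
  then show ?thesis using r c by (simp add: pos_le_divide_eq)
qed

text \<open>The rational and trigonometric cases differ only in how boundedness is proved. Given it,
  Liouville's theorem makes \<open>g\<close> quadratic, and oddness removes its linear term.\<close>

lemma gaussian_factor:
  assumes S: "S holomorphic_on UNIV" "\<And>z. S (- z) = - S z"
    and zeros: "\<And>z. f z = 0 \<longleftrightarrow> S z = 0" "\<And>z. S z = 0 \<Longrightarrow> deriv S z \<noteq> 0"
    and bounded: "\<And>g c \<delta>. g holomorphic_on UNIV \<Longrightarrow> (\<And>z. f z = S z * exp (g z)) \<Longrightarrow>
      (\<And>z. z \<noteq> 0 \<Longrightarrow> norm z < 3 * \<delta> \<Longrightarrow> f z \<noteq> 0) \<Longrightarrow> c \<noteq> 0 \<Longrightarrow> norm c < \<delta> \<Longrightarrow>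
      bounded (range (\<lambda>z. exp (2 * g z - g (z + c) - g (z - c))))"
  obtains \<alpha> \<beta> where "\<And>z. f z = S z * exp (\<alpha> * z\<^sup>2 + \<beta>)"
proof -
  obtain z0 where z0: "f z0 \<noteq> 0" using nonzero by blast
  obtain g where g: "g holomorphic_on UNIV" "\<And>z. f z = S z * exp (g z)"
    using entire_quotient_exp[OF hol S(1) zeros(1) _ z0] deriv_zero zeros by metis
  obtain \<delta> where \<delta>: "\<delta> > 0" "\<And>z. z \<noteq> 0 \<Longrightarrow> norm z < 3 * \<delta> \<Longrightarrow> f z \<noteq> 0"
    using zero_free_radius by blast
  have const: "(\<lambda>z. exp (2 * g z - g (z + h) - g (z - h))) constant_on UNIV" if "h \<noteq> 0" "norm h < \<delta>" for h
    by (rule Liouville_theorem[OF holomorphic_second_difference[OF g(1)] bounded[OF g \<delta>(2) that]])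
  obtain a b c where "\<And>z. g z = a * z\<^sup>2 + b * z + c"
    by (rule quadratic_of_second_differences[OF g(1) \<delta>(1) const]) (assumption | rule that)+
  then have q: "\<And>z. f z = S z * exp (a * z\<^sup>2 + b * z + c)" using g(2) by simp
  have Sz0: "S z0 \<noteq> 0" using z0 zeros(1) by blast
  have "f z = S z * exp (a * z\<^sup>2 + c)" for z
    by (rule odd_quotient_even_exponent[where b = b, OF S(1) Sz0 S(2) odd q])
  then show thesis by (rule that)
qed

lemma rational_case:
  assumes zeros: "{z. f z = 0} = {0}"
  obtains \<alpha> \<beta> where "\<And>z. f z = z * exp (\<alpha> * z\<^sup>2 + \<beta>)"
proof (rule gaussian_factor[of "\<lambda>z. z"])
  show z_iff: "f z = 0 \<longleftrightarrow> z = 0" for z using zeros by blast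
  fix g and c :: complex and \<delta> :: real
  assume g: "g holomorphic_on UNIV" "\<And>z. f z = z * exp (g z)"
    and \<delta>: "\<And>z. z \<noteq> 0 \<Longrightarrow> norm z < 3 * \<delta> \<Longrightarrow> f z \<noteq> 0" and c: "c \<noteq> 0" "norm c < \<delta>"
  let ?E = "\<lambda>z. exp (2 * g z - g (z + c) - g (z - c))"
  obtain r where r: "r > 0"
    "\<And>z. f z \<noteq> 0 \<Longrightarrow> (\<And>l. f l = 0 \<Longrightarrow> 2 * \<delta> \<le> norm (z - l)) \<Longrightarrow> r \<le> norm (\<phi> c z)"
    using \<phi>_lower_bound[OF \<delta> c] by blast
  have fc: "f c \<noteq> 0" using zeros c by blast
  have dpos: "\<delta> > 0" using c norm_ge_zero[of c] by linarith
  \<comment> \<open>Outside the disc \<open>\<phi>_lower_bound\<close> applies, and (z + c)(z - c) =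
    z^2 - c^2 has norm at most twice that of z^2. The disc itself is compact.\<close>
  have far: "norm (?E z) \<le> 2 / (r * (norm (f c))\<^sup>2)" if z: "2 * \<delta> \<le> norm z" for z
  proof (rule second_difference_bound[OF g(2) _ fc r(1)])
    show fz: "f z \<noteq> 0" using z dpos by (auto simp: z_iff)
    show "r \<le> norm (\<phi> c z)" using z by (intro r(2) fz) (simp add: z_iff)
    have "norm ((z + c) * (z - c)) = norm (z\<^sup>2 - c\<^sup>2)" by (simp add: power2_eq_square algebra_simps)
    also have "\<dots> \<le> (norm z)\<^sup>2 + (norm c)\<^sup>2" using norm_triangle_ineq4[of "z\<^sup>2" "c\<^sup>2"] by (simp add: norm_power)
    also have "(norm c)\<^sup>2 \<le> (norm z)\<^sup>2" using z c dpos by (intro power_mono) auto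
    finally show "norm ((z + c) * (z - c)) \<le> 2 * (norm z)\<^sup>2" by simp
  qed
  obtain M where M: "\<And>z. norm z \<le> 2 * \<delta> \<Longrightarrow> norm (?E z) \<le> M"
    by (rule entire_bounded_on_cball[OF holomorphic_second_difference[OF g(1)]]) (rule that)
  show "bounded (range ?E)"
    unfolding bounded_iff
    by (intro exI[of _ "max M (2 / (r * (norm (f c))\<^sup>2))"]) (use M far in \<open>auto simp: le_max_iff_disj\<close>, meson nle_le)
qed (auto simp: holomorphic_on_ident intro: that)

text \<open>By \<open>zero_translate_ratio\<close>, with both pairs of sum \<open>2 z\<close>, the
  quotient \<open>f (z + c) * f (z - c) / (f z)^2\<close> has period \<open>w\<close>. So has the
  same quotient for \<open>S\<close>, where the signs cancel; hence the exponential is periodic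
  too.\<close>

lemma second_difference_periodic:
  fixes c w z :: complex
  assumes g: "g holomorphic_on UNIV" and S: "S holomorphic_on UNIV" and eq: "\<And>z. f z = S z * exp (g z)"
    and per: "\<And>z. S (z + w) = - S z"
  shows "exp (2 * g (z + w) - g (z + w + c) - g (z + w - c)) = exp (2 * g z - g (z + c) - g (z - c))"
proof -
  let ?E = "\<lambda>z. exp (2 * g z - g (z + c) - g (z - c))"
  obtain z0 where z0: "f z0 \<noteq> 0" using nonzero by blast
  have Sz0: "S z0 \<noteq> 0" using eq z0 by auto
  \<comment> \<open>\<open>S 0 = 0\<close> because \<open>f 0 = 0\<close> and the exponential has no
    zeros; the sign rule for \<open>S\<close> carries this to \<open>w\<close>.\<close>
  have w: "f w = 0"
    using eq[of w] eq[of 0] per[of 0] f_0 by simp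
  define E where "E = ?E"
  have hE: "E holomorphic_on UNIV" unfolding E_def by (rule holomorphic_second_difference[OF g])
  have Ew: "(\<lambda>z. E (z + w)) holomorphic_on UNIV" and fp: "(\<lambda>z. f (z + c)) holomorphic_on UNIV"
    and fw: "(\<lambda>z. f (z + w)) holomorphic_on UNIV"
    by (intro holomorphic_shift hE hol)+
  have fm: "(\<lambda>z. f (z - c)) holomorphic_on UNIV" using holomorphic_shift[OF hol, of "- c"] by simp
  have "?E (z + w) * (S z)\<^sup>2 * (f (z + w))\<^sup>2 * f (z + c) * f (z - c) = ?E z * (S z)\<^sup>2 * (f (z + w))\<^sup>2 * f (z + c) * f (z - c)" for z
  proof -
    have "f (z + w) * f (z + w) * f (z + c) * f (z - c) = f (z + c + w) * f (z - c + w) * f z * f z"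
      by (rule zero_translate_ratio[OF w]) simp
    then have T: "(f (z + w))\<^sup>2 * (f (z + c) * f (z - c)) = (f (z + w + c) * f (z + w - c)) * (f z)\<^sup>2"
      by (simp add: power2_eq_square algebra_simps)
    have S2: "S (z + w + c) * S (z + w - c) = S (z + c) * S (z - c)" "(S (z + w))\<^sup>2 = (S z)\<^sup>2"
      using per[of "z + c"] per[of "z - c"] per[of z] by (simp_all add: algebra_simps)
    have "?E (z + w) * (S z)\<^sup>2 * ((f (z + w))\<^sup>2 * (f (z + c) * f (z - c)))
        = (?E (z + w) * (S (z + w))\<^sup>2 * (f (z + w + c) * f (z + w - c))) * (f z)\<^sup>2"
      unfolding T S2 by (simp only: mult_ac)
    also have "\<dots> = (f (z + w))\<^sup>2 * ((f z)\<^sup>2 * (S (z + c) * S (z - c)))"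
      unfolding second_difference_eq[OF eq, of "z + w" c] S2(1) by (simp only: mult_ac)
    also have "\<dots> = (f (z + w))\<^sup>2 * (?E z * (S z)\<^sup>2 * (f (z + c) * f (z - c)))"
      unfolding second_difference_eq[OF eq] ..
    finally show ?thesis by (simp only: mult_ac)
  qed
  \<comment> \<open>The common factors are now cancelled one at a time by
    \<open>entire_cancel\<close>; none of them vanishes identically.\<close>
  then have M4: "E (z + w) * ((S z)\<^sup>2 * (f (z + w))\<^sup>2 * f (z + c)) * f (z - c)
      = E z * ((S z)\<^sup>2 * (f (z + w))\<^sup>2 * f (z + c)) * f (z - c)" for z
    unfolding E_def by (simp only: mult_ac)
  have M3: "E (z + w) * ((S z)\<^sup>2 * (f (z + w))\<^sup>2) * f (z + c) = E z * ((S z)\<^sup>2 * (f (z + w))\<^sup>2) * f (z + c)" for z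
    unfolding mult.assoc[of "E _"]
    by (rule entire_cancel[OF _ _ fm, where y = "z0 + c", OF _ _ _ M4])
       (intro holomorphic_intros S hE Ew fp fw | simp add: z0)+
  have M2: "E (z + w) * (S z)\<^sup>2 * (f (z + w))\<^sup>2 = E z * (S z)\<^sup>2 * (f (z + w))\<^sup>2" for z
    unfolding mult.assoc[of "E _"]
    by (rule entire_cancel[OF _ _ fp, where y = "z0 - c", OF _ _ _ M3])
       (intro holomorphic_intros S hE Ew fw | simp add: z0)+
  have M1: "E (z + w) * (S z)\<^sup>2 = E z * (S z)\<^sup>2" for z
    by (rule entire_cancel[OF _ _ holomorphic_on_power[OF fw, where n = 2], where y = "z0 - w", OF _ _ _ M2])
       (intro holomorphic_intros S hE Ew | simp add: z0)+
  have "E (z + w) = E z"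
    by (rule entire_cancel[OF Ew hE holomorphic_on_power[OF S, where n = 2], where y = z0, OF _ M1]) (simp add: Sz0)
  then show ?thesis by (simp add: E_def)
qed

lemma trigonometric_case:
  assumes w: "w \<noteq> 0" and zeros: "{z. f z = 0} = {of_int n * w | n :: int. True}"
  obtains a \<alpha> \<beta> where "a \<noteq> 0" "\<And>z. f z = sin (a * z) * exp (\<alpha> * z\<^sup>2 + \<beta>)"
proof -
  \<comment> \<open>With this \<open>a\<close> the zeros of \<open>sin (a * z)\<close> are exactly
    the integer multiples of \<open>w\<close>.\<close>
  define a where "a = of_real pi / w"
  have a0: "a \<noteq> 0" and aw: "a * w = of_real pi" using w by (simp_all add: a_def)
  have z_iff: "f z = 0 \<longleftrightarrow> sin (a * z) = 0" for z
  proof -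
    have "f z = 0 \<longleftrightarrow> (\<exists>n::int. z = of_int n * w)" using zeros by blast
    also have "\<dots> \<longleftrightarrow> (\<exists>n::int. a * z = of_real (of_int n * pi))"
    proof (intro arg_cong[of _ _ Ex] ext)
      fix n :: int
      have "z = of_int n * w \<longleftrightarrow> a * z = a * (of_int n * w)" using a0 by simp
      also have "a * (of_int n * w) = of_real (of_int n * pi)" using aw by (simp add: mult_ac)
      finally show "(z = of_int n * w) = (a * z = of_real (of_int n * pi))" .
    qed
    finally show ?thesis by (simp only: sin_eq_0)
  qed
  have hS: "(\<lambda>z. sin (a * z)) holomorphic_on UNIV" by (intro holomorphic_intros)
  have dS: "deriv (\<lambda>z. sin (a * z)) z = a * cos (a * z)" for z
    by (rule DERIV_imp_deriv) (rule derivative_eq_intros | simp)+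
  have per: "sin (a * (z + w)) = - sin (a * z)" for z
    by (simp add: distrib_left aw sin_add flip: sin_of_real cos_of_real)
  obtain \<alpha> \<beta> where "\<And>z. f z = sin (a * z) * exp (\<alpha> * z\<^sup>2 + \<beta>)"
  proof (rule gaussian_factor[of "\<lambda>z. sin (a * z)"])
    show "deriv (\<lambda>z. sin (a * z)) z \<noteq> 0" if "sin (a * z) = 0" for z
      using that a0 sin_cos_squared_add[of "a * z"] by (auto simp: dS)
    fix g and c :: complex and \<delta> :: real
    assume g: "g holomorphic_on UNIV" "\<And>z. f z = sin (a * z) * exp (g z)"
      and \<delta>: "\<And>z. z \<noteq> 0 \<Longrightarrow> norm z < 3 * \<delta> \<Longrightarrow> f z \<noteq> 0" and c: "c \<noteq> 0" "norm c < \<delta>"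
    let ?E = "\<lambda>z. exp (2 * g z - g (z + c) - g (z - c))"
    obtain r where r: "r > 0"
      "\<And>z. f z \<noteq> 0 \<Longrightarrow> (\<And>l. f l = 0 \<Longrightarrow> 2 * \<delta> \<le> norm (z - l)) \<Longrightarrow> r \<le> norm (\<phi> c z)"
      using \<phi>_lower_bound[OF \<delta> c] by blast
    have dpos: "\<delta> > 0" using c norm_ge_zero[of c] by linarith
    have fc: "f c \<noteq> 0" by (rule \<delta>) (use c dpos in auto)
    \<comment> \<open>Zeros satisfy \<open>Im (a * l) = 0\<close>, so |Im (a z)| \<ge> M keeps
      \<open>z\<close> at distance at least \<open>2 * \<delta>\<close> from all of them; the
      summand 1 serves \<open>norm_sin_lower_bound\<close>.\<close>
    define M where "M = norm a * (2 * \<delta>) + 1"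
    have M1: "M \<ge> 1" using dpos by (simp add: M_def)
    \<comment> \<open>The lower bound 3/4 gives 1 \<le> 2 |sin (a z)|^2, which turns the constant
      |sin (a c)|^2 into a multiple of |sin (a z)|^2.\<close>
    define b where "b = 1 + 2 * (norm (sin (a * c)))\<^sup>2"
    have far: "norm (?E z) \<le> b / (r * (norm (f c))\<^sup>2)" if z: "M \<le> \<bar>Im (a * z)\<bar>" for z
    proof (rule second_difference_bound[OF g(2) _ fc r(1)])
      have s: "3 / 4 \<le> (norm (sin (a * z)))\<^sup>2"
        by (rule norm_sin_lower_bound) (use z M1 in linarith)
      then show fz: "f z \<noteq> 0" using z_iff by auto
      have "2 * \<delta> \<le> norm (z - l)" if l: "f l = 0" for l
      proof (rule ccontr)
        assume "\<not> 2 * \<delta> \<le> norm (z - l)"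
        then have "norm (a * (z - l)) \<le> norm a * (2 * \<delta>)" unfolding norm_mult by (intro mult_left_mono) auto
        moreover have "\<bar>Im (a * (z - l))\<bar> \<le> norm (a * (z - l))" by (rule abs_Im_le_cmod)
        moreover have "Im (a * (z - l)) = Im (a * z)"
        proof -
          obtain n :: int where "l = of_int n * w" using l zeros by blast
          then have "a * l = of_int n * (a * w)" by simp
          then have "Im (a * l) = 0" by (simp add: aw)
          then show ?thesis by (simp add: right_diff_distrib)
        qed
        ultimately show False using z by (simp add: M_def)
      qed
      then show "r \<le> norm (\<phi> c z)" by (intro r(2) fz)
      have "norm (sin (a * (z + c)) * sin (a * (z - c))) = norm ((sin (a * z))\<^sup>2 - (sin (a * c))\<^sup>2)"
        by (simp add: distrib_left right_diff_distrib sin_add_times_sin_diff)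
      also have "\<dots> \<le> (norm (sin (a * z)))\<^sup>2 + (norm (sin (a * c)))\<^sup>2"
        by (metis norm_power norm_triangle_ineq4)
      also have "\<dots> \<le> (norm (sin (a * z)))\<^sup>2 + 2 * (norm (sin (a * c)))\<^sup>2 * (norm (sin (a * z)))\<^sup>2"
      proof -
        have "(norm (sin (a * c)))\<^sup>2 * 1 \<le> (norm (sin (a * c)))\<^sup>2 * (2 * (norm (sin (a * z)))\<^sup>2)"
          using s by (intro mult_left_mono) auto
        then show ?thesis by simp
      qed
      finally show "norm (sin (a * (z + c)) * sin (a * (z - c))) \<le> b * (norm (sin (a * z)))\<^sup>2"
        by (simp add: b_def algebra_simps)
    qed
    have E1: "?E (z + w) = ?E z" for z
      by (rule second_difference_periodic[OF g(1) hS g(2) per])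
    have En: "?E (z + of_int n * w) = ?E z" for z and n :: int
    proof (induction n rule: int_induct[of _ 0])
      case (step1 i)
      then show ?case using E1[of "z + of_int i * w"] by (simp add: algebra_simps)
    next
      case (step2 i)
      then show ?case using E1[of "z + of_int (i - 1) * w"] by (simp add: algebra_simps)
    qed simp
    \<comment> \<open>Modulo \<open>w\<close> one has |Re (a y)| \<le> pi; the part of this strip
      with |Im (a y)| < M lies in the disc of radius \<open>R\<close>.\<close>
    define R where "R = (pi + M) / norm a"
    obtain N where N: "\<And>z. norm z \<le> R \<Longrightarrow> norm (?E z) \<le> N"
      by (rule entire_bounded_on_cball[OF holomorphic_second_difference[OF g(1)]]) (rule that)
    have "norm (?E z) \<le> max N (b / (r * (norm (f c))\<^sup>2))" for z
    proof -
      define n where "n = - \<lfloor>Re (a * z) / pi\<rfloor>"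
      define y where "y = z + of_int n * w"
      have ay: "a * y = a * z + of_real (of_int n * pi)" by (simp add: y_def distrib_left aw mult.left_commute)
      have Re: "\<bar>Re (a * y)\<bar> \<le> pi"
      proof -
        have f0: "0 \<le> Re (a * z) / pi + of_int n" "Re (a * z) / pi + of_int n \<le> 1"
          unfolding n_def by linarith+
        have "Re (a * y) = (Re (a * z) / pi + of_int n) * pi" unfolding ay by (simp add: field_simps)
        moreover have "0 \<le> (Re (a * z) / pi + of_int n) * pi" using f0 by simp
        moreover have "(Re (a * z) / pi + of_int n) * pi \<le> 1 * pi" using f0 by (intro mult_right_mono) auto
        ultimately show ?thesis by simp
      qed
      have "norm (?E y) \<le> max N (b / (r * (norm (f c))\<^sup>2))"
      proof (cases "M \<le> \<bar>Im (a * y)\<bar>")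
        case True
        then show ?thesis using far by (simp add: le_max_iff_disj)
      next
        case False
        then have "norm (a * y) \<le> pi + M" using Re cmod_le[of "a * y"] by linarith
        then have "norm y \<le> R" using a0 by (simp add: R_def norm_mult field_simps)
        then show ?thesis using N by (simp add: le_max_iff_disj)
      qed
      then show ?thesis unfolding y_def En .
    qed
    then show "bounded (range ?E)" unfolding bounded_iff by blast
  qed (use z_iff hS in auto)
  with a0 show thesis using that by blast
qed

end

section \<open>Lattices of zeros\<close>

text \<open>Since \<open>1 / 0 = 0\<close>, the term for \<open>l = 0\<close> is \<open>1 / z\<close>; so the sum over the whole lattice is
  the Weierstrass zeta function.\<close>
definition zeta_term :: "complex \<Rightarrow> complex \<Rightarrow> complex" where
  "zeta_term z l = 1 / (z - l) + 1 / l + z / l\<^sup>2"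

text \<open>The three summands combine to \<open>z^2 / (l^2 * (z - l))\<close>, and |z - l| is at
  least |l| / 2.\<close>

lemma norm_zeta_term_le:
  assumes l: "l \<noteq> 0" and z: "2 * norm z \<le> norm l"
  shows "norm (zeta_term z l) \<le> 2 * (norm z)\<^sup>2 * (1 / norm l ^ 3)"
proof -
  have nl: "norm l > 0" using l by simp
  have d: "norm l / 2 \<le> norm (z - l)"
    using norm_triangle_ineq2[of l z] z by (simp add: norm_minus_commute)
  then have zl: "z - l \<noteq> 0" using nl by auto
  have "zeta_term z l = z\<^sup>2 / (l\<^sup>2 * (z - l))"
    using l zl by (simp add: zeta_term_def field_simps) (simp add: algebra_simps power2_eq_square power4_eq_xxxx)
  then have "norm (zeta_term z l) = (norm z)\<^sup>2 / ((norm l)\<^sup>2 * norm (z - l))"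
    by (simp add: norm_divide norm_mult norm_power)
  also have "\<dots> \<le> (norm z)\<^sup>2 / ((norm l)\<^sup>2 * (norm l / 2))"
    using d nl zl by (intro divide_left_mono mult_left_mono mult_pos_pos) auto
  also have "\<dots> = 2 * (norm z)\<^sup>2 * (1 / norm l ^ 3)" by (simp add: power2_eq_square power3_eq_cube)
  finally show ?thesis .
qed

definition sigma_product :: "complex set \<Rightarrow> complex \<Rightarrow> complex" where
  "sigma_product F z = z * (\<Prod>l\<in>F. (1 - z / l) * exp (z / l + (z / l)\<^sup>2 / 2))"

text \<open>This is logarithmic differentiation; the leading factor \<open>z\<close> contributes
  \<open>zeta_term z 0 = 1 / z\<close>, hence the inserted 0.\<close>

lemma sigma_product_has_deriv:
  assumes F: "finite F" "0 \<notin> F" and z: "z \<noteq> 0" "z \<notin> F"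
  shows "(sigma_product F has_field_derivative sigma_product F z * (\<Sum>l\<in>insert 0 F. zeta_term z l)) (at z)"
  using F z
proof (induction F rule: finite_induct)
  case empty
  then show ?case by (simp add: sigma_product_def[abs_def] zeta_term_def)
next
  case (insert l F)
  let ?e = "\<lambda>z. (1 - z / l) * exp (z / l + (z / l)\<^sup>2 / 2)"
  have l: "l \<noteq> 0" "z - l \<noteq> 0" "l - z \<noteq> 0" using insert.prems by auto
  have IH: "(sigma_product F has_field_derivative sigma_product F z * (\<Sum>l\<in>insert 0 F. zeta_term z l)) (at z)"
    using insert by auto
  have "(?e has_field_derivative - (1 / l) * exp (z / l + (z / l)\<^sup>2 / 2)
      + exp (z / l + (z / l)\<^sup>2 / 2) * (1 / l + z / l\<^sup>2) * (1 - z / l)) (at z)"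
    using l by (auto intro!: derivative_eq_intros simp: power2_eq_square field_simps)
  moreover have "- (1 / l) * exp (z / l + (z / l)\<^sup>2 / 2) + exp (z / l + (z / l)\<^sup>2 / 2) * (1 / l + z / l\<^sup>2) * (1 - z / l)
      = ?e z * zeta_term z l"
  proof -
    define c p q E where "c = 1 - z / l" and "p = 1 / (z - l)" and "q = 1 / l + z / l\<^sup>2"
      and "E = exp (z / l + (z / l)\<^sup>2 / 2)"
    have "- (1 / l) = c * p" using l by (simp add: c_def p_def field_simps)
    then have "- (1 / l) * E + E * q * c = c * E * (p + q)" by (simp only: algebra_simps)
    then show ?thesis by (simp only: zeta_term_def c_def p_def q_def E_def add.assoc)
  qed
  ultimately have e: "(?e has_field_derivative ?e z * zeta_term z l) (at z)" by simp
  have P: "sigma_product (insert l F) = (\<lambda>z. sigma_product F z * ?e z)"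
    using insert.hyps by (intro ext) (simp add: sigma_product_def mult_ac)
  have S: "(\<Sum>m\<in>insert 0 (insert l F). zeta_term z m) = zeta_term z l + (\<Sum>m\<in>insert 0 F. zeta_term z m)"
    using insert.hyps l by (subst insert_commute) simp
  show ?case
    unfolding P S by (rule DERIV_cong[OF DERIV_mult[OF IH e]]) (simp only: distrib_left distrib_right mult_ac add_ac)
qed

locale lattice_zeros = three_term_equation +
  fixes L :: "complex set"
  assumes lattice: "is_lattice L" and zeros: "\<And>z. f z = 0 \<longleftrightarrow> z \<in> L"
begin

lemma L_0: "0 \<in> L"
  using zeros f_0 by blast

lemma L_add: "u \<in> L \<Longrightarrow> v \<in> L \<Longrightarrow> u + v \<in> L" and L_diff: "u \<in> L \<Longrightarrow> v \<in> L \<Longrightarrow> u - v \<in> L"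
  using zero_add_diff zeros by blast+

lemma L_uminus: "u \<in> L \<Longrightarrow> - u \<in> L"
  using L_diff[OF L_0] by fastforce

lemma L_finite: "finite {l \<in> L. norm l \<le> R}"
proof -
  obtain z0 where "f z0 \<noteq> 0" using nonzero by blast
  from entire_zeros_finite[OF hol this, of R] show ?thesis by (simp add: zeros)
qed

lemma L_isolated: "\<exists>e>0. ball z e \<inter> L \<subseteq> {z}"
proof -
  obtain z0 where "f z0 \<noteq> 0" using nonzero by blast
  from entire_zeros_isolated[OF hol this, of z] show ?thesis by (simp add: zeros)
qed

lemma L_countable: "countable L"
proof -
  have "L = (\<Union>n. {l \<in> L. norm l \<le> real n})" using real_arch_simple by blast
  moreover have "countable (\<Union>n. {l \<in> L. norm l \<le> real n})"
    by (intro countable_UN countable_finite L_finite countableI_type)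
  ultimately show ?thesis by simp
qed

lemma L_closed: "closed L"
proof -
  have "closed {z. f z = 0}"
    by (rule closed_Collect_eq[OF holomorphic_on_imp_continuous_on[OF hol] continuous_on_const])
  then show ?thesis by (simp add: zeros)
qed

lemma L_summable: "(\<lambda>l. 1 / norm l ^ 3) summable_on L"
  by (rule lattice_summable[OF lattice])

lemma L_summable_tail: "(\<lambda>l. 1 / norm l ^ 3) summable_on {l \<in> L. R < norm l}"
  by (rule summable_on_subset_banach[OF L_summable]) auto

section \<open>The Weierstrass zeta function of the lattice\<close>

definition tail :: "real \<Rightarrow> complex \<Rightarrow> complex" where
  "tail R z = (\<Sum>\<^sub>\<infinity>l\<in>{l \<in> L. R < norm l}. zeta_term z l)"

definition tail_mass :: "real \<Rightarrow> real" where
  "tail_mass R = (\<Sum>\<^sub>\<infinity>l\<in>{l \<in> L. R < norm l}. 1 / norm l ^ 3)"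

definition zeta :: "complex \<Rightarrow> complex" where
  "zeta z = (\<Sum>\<^sub>\<infinity>l\<in>L. zeta_term z l)"

lemma zeta_term_tail_le:
  assumes "2 * norm z \<le> R" "l \<in> {l \<in> L. R < norm l}"
  shows "norm (zeta_term z l) \<le> 2 * (norm z)\<^sup>2 * (1 / norm l ^ 3)"
proof -
  have "2 * norm z \<le> norm l" using assms by simp
  moreover have "R < norm l" using assms by simp
  then have "l \<noteq> 0" using assms(1) norm_ge_zero[of z] by (metis dual_order.trans less_le_not_le mult_nonneg_nonneg norm_zero zero_le_numeral)
  ultimately show ?thesis by (intro norm_zeta_term_le)
qed

lemma tail_abs_summable:
  assumes "2 * norm z \<le> R"
  shows "(\<lambda>l. norm (zeta_term z l)) summable_on {l \<in> L. R < norm l}"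
  by (rule Infinite_Sum.abs_summable_on_comparison_test'[OF summable_on_cmult_right[OF L_summable_tail] zeta_term_tail_le[OF assms]])

lemma norm_tail_le:
  assumes "2 * norm z \<le> R"
  shows "norm (tail R z) \<le> 2 * (norm z)\<^sup>2 * tail_mass R"
  unfolding tail_def tail_mass_def
  by (rule norm_infsum_le[OF has_sum_infsum[OF abs_summable_summable[OF tail_abs_summable[OF assms]]]
        has_sum_cmult_right[OF has_sum_infsum[OF L_summable_tail]] zeta_term_tail_le[OF assms]])

lemma tail_mass_tendsto: "(tail_mass \<longlongrightarrow> 0) at_top"
proof -
  let ?g = "\<lambda>l::complex. 1 / norm l ^ 3"
  have F: "filterlim (\<lambda>R. {l \<in> L. norm l \<le> R}) (finite_subsets_at_top L) at_top"
    unfolding filterlim_finite_subsets_at_top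
  proof safe
    fix X assume X: "finite X" "X \<subseteq> L"
    have "\<forall>\<^sub>F R in at_top. Max (insert 0 (norm ` X)) \<le> R" by (rule eventually_ge_at_top)
    then show "\<forall>\<^sub>F R in at_top. finite {l \<in> L. norm l \<le> R} \<and> X \<subseteq> {l \<in> L. norm l \<le> R} \<and> {l \<in> L. norm l \<le> R} \<subseteq> L"
    proof eventually_elim
      case (elim R)
      then show ?case using X L_finite[of R] by auto
    qed
  qed
  have "(sum ?g \<longlongrightarrow> infsum ?g L) (finite_subsets_at_top L)"
    using has_sum_infsum[OF L_summable] by (simp add: has_sum_def)
  from filterlim_compose[OF this F]
  have "((\<lambda>R. infsum ?g L - sum ?g {l \<in> L. norm l \<le> R}) \<longlongrightarrow> infsum ?g L - infsum ?g L) at_top"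
    by (intro tendsto_diff tendsto_const)
  moreover have "infsum ?g L - sum ?g {l \<in> L. norm l \<le> R} = tail_mass R" for R
  proof -
    have "L = {l \<in> L. norm l \<le> R} \<union> {l \<in> L. R < norm l}" by auto
    then have "infsum ?g L = infsum ?g ({l \<in> L. norm l \<le> R} \<union> {l \<in> L. R < norm l})" by simp
    also have "\<dots> = sum ?g {l \<in> L. norm l \<le> R} + tail_mass R"
      unfolding tail_mass_def using L_finite L_summable_tail by (subst infsum_Un_disjoint) auto
    finally show ?thesis by simp
  qed
  ultimately show ?thesis by simp
qed

text \<open>In the disc of radius \<open>R / 2\<close> all poles sit in the finite sum and the tail
  converges absolutely. Holomorphy and residues of \<open>zeta\<close> are read off this
  splitting.\<close>

lemma zeta_split:
  assumes R: "2 * norm z \<le> R"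
  shows "zeta_term z summable_on L" "zeta z = (\<Sum>l\<in>{l \<in> L. norm l \<le> R}. zeta_term z l) + tail R z"
proof -
  have L: "L = {l \<in> L. norm l \<le> R} \<union> {l \<in> L. R < norm l}" by auto
  have disj: "{l \<in> L. norm l \<le> R} \<inter> {l \<in> L. R < norm l} = {}" by auto
  note s = summable_on_finite[OF L_finite[of R], of "zeta_term z"] abs_summable_summable[OF tail_abs_summable[OF R]]
  show "zeta_term z summable_on L"
    using summable_on_Un_disjoint[OF s disj] unfolding L[symmetric] .
  show "zeta z = (\<Sum>l\<in>{l \<in> L. norm l \<le> R}. zeta_term z l) + tail R z"
    using infsum_Un_disjoint[OF s disj] unfolding L[symmetric] zeta_def tail_def by (simp add: L_finite)
qed

lemma has_sum_zeta: "(zeta_term z has_sum zeta z) L"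
  unfolding zeta_def using zeta_split(1) has_sum_infsum by blast

text \<open>On this disc |z| \<le> R / 2 bounds the terms by a summable sequence independent of
  \<open>z\<close>, so the Weierstrass M-test applies.\<close>

lemma holomorphic_tail: "tail R holomorphic_on ball 0 (R / 2)"
proof -
  have ul: "uniform_limit (cball 0 (R / 2)) (\<lambda>X z. \<Sum>l\<in>X. zeta_term z l) (\<lambda>z. \<Sum>\<^sub>\<infinity>l\<in>{l \<in> L. R < norm l}. zeta_term z l)
      (finite_subsets_at_top {l \<in> L. R < norm l})"
  proof (rule Weierstrass_m_test_general)
    show "norm (zeta_term z l) \<le> 2 * (R / 2)\<^sup>2 * (1 / norm l ^ 3)"
      if l: "l \<in> {l \<in> L. R < norm l}" and z: "z \<in> cball 0 (R / 2)" for l z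
    proof -
      have "norm (zeta_term z l) \<le> 2 * (norm z)\<^sup>2 * (1 / norm l ^ 3)"
        using z by (intro zeta_term_tail_le[OF _ l]) simp
      also have "\<dots> \<le> 2 * (R / 2)\<^sup>2 * (1 / norm l ^ 3)"
        using z by (intro mult_right_mono mult_left_mono power_mono) auto
      finally show ?thesis .
    qed
    show "(\<lambda>l. 2 * (R / 2)\<^sup>2 * (1 / norm l ^ 3)) summable_on {l \<in> L. R < norm l}"
      by (rule summable_on_cmult_right[OF L_summable_tail])
  qed
  have ev: "\<forall>\<^sub>F X in finite_subsets_at_top {l \<in> L. R < norm l}.
     continuous_on (cball 0 (R / 2)) (\<lambda>z. \<Sum>l\<in>X. zeta_term z l) \<and> (\<lambda>z. \<Sum>l\<in>X. zeta_term z l) holomorphic_on ball 0 (R / 2)"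
  proof (rule eventually_finite_subsets_at_top_weakI)
    fix X assume X: "finite X" "X \<subseteq> {l \<in> L. R < norm l}"
    have "zeta_term z l = 1 / (z - l) + 1 / l + z * (1 / l\<^sup>2)" for z l by (simp add: zeta_term_def)
    moreover have "z - l \<noteq> 0" if "z \<in> cball 0 (R / 2)" "l \<in> X" for z l
    proof
      assume "z - l = 0"
      then have "2 * norm l \<le> R" using that(1) by simp
      moreover have "R < norm l" using that(2) X by auto
      ultimately show False using norm_ge_zero[of l] by linarith
    qed
    ultimately have "(\<lambda>z. \<Sum>l\<in>X. zeta_term z l) holomorphic_on cball 0 (R / 2)"
      by (auto intro!: holomorphic_intros)
    then show "continuous_on (cball 0 (R / 2)) (\<lambda>z. \<Sum>l\<in>X. zeta_term z l) \<and> (\<lambda>z. \<Sum>l\<in>X. zeta_term z l) holomorphic_on ball 0 (R / 2)"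
      using holomorphic_on_imp_continuous_on holomorphic_on_subset ball_subset_cball by blast
  qed
  show ?thesis
    unfolding tail_def[abs_def] by (rule holomorphic_uniform_limit[OF ev ul finite_subsets_at_top_neq_bot])
qed

lemma holomorphic_zeta_sum:
  "(\<lambda>z. \<Sum>l\<in>{l \<in> L. norm l \<le> R}. zeta_term z l) holomorphic_on - L"
proof -
  have "zeta_term z l = 1 / (z - l) + 1 / l + z * (1 / l\<^sup>2)" for z l by (simp add: zeta_term_def)
  then show ?thesis by (auto intro!: holomorphic_intros)
qed

lemma holomorphic_zeta: "zeta holomorphic_on - L"
proof -
  have "zeta holomorphic_on ball 0 (R / 2) - L" for R
  proof (rule holomorphic_transform)
    show "(\<lambda>z. (\<Sum>l\<in>{l \<in> L. norm l \<le> R}. zeta_term z l) + tail R z) holomorphic_on ball 0 (R / 2) - L"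
      by (intro holomorphic_intros holomorphic_on_subset[OF holomorphic_zeta_sum] holomorphic_on_subset[OF holomorphic_tail]) auto
    show "(\<Sum>l\<in>{l \<in> L. norm l \<le> R}. zeta_term z l) + tail R z = zeta z" if "z \<in> ball 0 (R / 2) - L" for z
      using that by (subst zeta_split(2)[of z R]) auto
  qed
  then have "zeta holomorphic_on (\<Union>R\<in>UNIV. ball 0 (R / 2) - L)"
    using L_closed by (intro holomorphic_on_UN_open) auto
  moreover have "z \<in> (\<Union>R\<in>UNIV. ball 0 (R / 2) - L)" if "z \<notin> L" for z :: complex
    using that by (auto intro!: exI[of _ "2 * norm z + 2"])
  ultimately show ?thesis by (elim holomorphic_on_subset) auto
qed

lemma zeta_residue:
  assumes l: "l \<in> L"
  shows "((\<lambda>z. (z - l) * zeta z) \<longlongrightarrow> 1) (at l)"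
proof -
  define R where "R = 2 * norm l + 2"
  have lR: "l \<in> ball 0 (R / 2)" by (simp add: R_def)
  have single: "((\<lambda>z. (z - l) * zeta_term z m) \<longlongrightarrow> (if m = l then 1 else 0)) (at l)" for m
  proof (cases "m = l")
    case True
    \<comment> \<open>The form with \<open>inverse\<close> also covers \<open>l = 0\<close>, where
      both correction terms are 0.\<close>
    have "((\<lambda>z. 1 + (z - l) * (1 / l + z / l\<^sup>2)) \<longlongrightarrow> 1 + (l - l) * (1 / l + l * inverse (l\<^sup>2))) (at l)"
      unfolding divide_inverse by (intro tendsto_intros)
    moreover have "\<forall>\<^sub>F z in at l. 1 + (z - l) * (1 / l + z / l\<^sup>2) = (z - l) * zeta_term z m"
      by (auto simp: eventually_at_filter True zeta_term_def distrib_left intro!: always_eventually)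
    ultimately show ?thesis using True by (auto elim: Lim_transform_eventually)
  next
    case False
    have "((\<lambda>z. (z - l) * zeta_term z m) \<longlongrightarrow> (l - l) * (1 / (l - m) + 1 / m + l * inverse (m\<^sup>2))) (at l)"
      unfolding zeta_term_def divide_inverse[of _ "m\<^sup>2"] by (intro tendsto_intros) (use False in auto)
    then show ?thesis using False by simp
  qed
  have "isCont (tail R) l"
    using holomorphic_on_imp_continuous_on[OF holomorphic_tail] lR by (simp add: continuous_on_eq_continuous_at)
  then have "((\<lambda>z. (\<Sum>m\<in>{m \<in> L. norm m \<le> R}. (z - l) * zeta_term z m) + (z - l) * tail R z)
      \<longlongrightarrow> (\<Sum>m\<in>{m \<in> L. norm m \<le> R}. if m = l then 1 else 0) + (l - l) * tail R l) (at l)"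
    by (intro tendsto_intros single) (simp add: isCont_def)
  moreover have "(\<Sum>m\<in>{m \<in> L. norm m \<le> R}. if m = l then 1 else 0) = (1::complex)"
  proof -
    have "l \<in> {m \<in> L. norm m \<le> R}" using l by (simp add: R_def)
    then show ?thesis by (subst sum.delta[OF L_finite]) simp
  qed
  moreover have "\<forall>\<^sub>F z in at l. (\<Sum>m\<in>{m \<in> L. norm m \<le> R}. (z - l) * zeta_term z m) + (z - l) * tail R z = (z - l) * zeta z"
  proof -
    have "\<forall>\<^sub>F z in at l. z \<in> ball 0 (R / 2)"
      by (rule eventually_at_in_open') (use lR in auto)
    then show ?thesis
    proof eventually_elim
      case (elim z)
      then show ?case by (subst zeta_split(2)[of z R]) (auto simp: distrib_left sum_distrib_left)
    qed
  qed
  ultimately show ?thesis by (auto elim: Lim_transform_eventually)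
qed

lemma zeta_odd: "zeta (- z) = - zeta z"
proof -
  have neg: "zeta_term (- z) (- l) = - zeta_term z l" for l
  proof -
    have "1 / (- z - - l) = - (1 / (z - l))" by (metis minus_diff_minus divide_minus_right)
    then show ?thesis by (simp add: zeta_term_def)
  qed
  have "zeta (- z) = (\<Sum>\<^sub>\<infinity>l\<in>L. - zeta_term z l)"
    unfolding zeta_def
    by (rule infsum_reindex_bij_witness[of _ uminus uminus]) (auto intro: L_uminus simp flip: neg)
  then show ?thesis by (simp add: infsum_uminus zeta_def)
qed

text \<open>The corrections \<open>1 / l + z / l^2\<close> are affine in \<open>z\<close> and drop
  out of a second difference. What remains depends only on \<open>z - l\<close>, so a shift by
  \<open>u\<close> permutes the terms.\<close>

lemma zeta_second_difference_periodic:
  assumes u: "u \<in> L"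
  shows "zeta (z + u + 2 * h) - 2 * zeta (z + u + h) + zeta (z + u)
    = zeta (z + 2 * h) - 2 * zeta (z + h) + zeta z"
proof -
  define d where "d w = 1 / (w + 2 * h) - 2 * (1 / (w + h)) + 1 / w" for w
  have sum: "zeta (z + 2 * h) - 2 * zeta (z + h) + zeta z = (\<Sum>\<^sub>\<infinity>l\<in>L. d (z - l))" for z
  proof -
    have "((\<lambda>l. zeta_term (z + 2 * h) l + (- 2) * zeta_term (z + h) l + zeta_term z l) has_sum
        (zeta (z + 2 * h) + (- 2) * zeta (z + h) + zeta z)) L"
      by (intro has_sum_add has_sum_cmult_right has_sum_zeta)
    moreover have "zeta_term (z + 2 * h) l + (- 2) * zeta_term (z + h) l + zeta_term z l = d (z - l)" for l
      by (simp add: zeta_term_def d_def diff_add_eq add_divide_distrib algebra_simps)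
    ultimately show ?thesis by (simp add: infsumI)
  qed
  have "(\<Sum>\<^sub>\<infinity>l\<in>L. d (z + u - l)) = (\<Sum>\<^sub>\<infinity>l\<in>L. d (z - l))"
    by (rule infsum_reindex_bij_witness[of _ "\<lambda>l. l + u" "\<lambda>l. l - u"]) (auto intro: L_add L_diff u simp: algebra_simps)
  then show ?thesis unfolding sum .
qed

section \<open>The logarithmic derivative of f and convergence of the sigma product\<close>

lemma log_deriv_eq:
  obtains \<gamma> where "\<And>z. z \<notin> L \<Longrightarrow> deriv f z / f z = \<gamma> * z + zeta z"
proof -
  have hf': "deriv f holomorphic_on UNIV" using hol by (simp add: holomorphic_deriv)
  have "(\<lambda>z. deriv f z / f z - zeta z) holomorphic_on - L"
    by (intro holomorphic_intros holomorphic_zeta holomorphic_on_subset[OF hol] holomorphic_on_subset[OF hf']) (auto simp: zeros)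
  \<comment> \<open>Both \<open>f' / f\<close> and \<open>zeta\<close> have a simple pole of residue
    1 at \<open>l\<close>, so the singularity of the difference is removable.\<close>
  moreover have "((\<lambda>z. (z - l) * (deriv f z / f z - zeta z)) \<longlongrightarrow> 0) (at l)" if l: "l \<in> L" for l
  proof -
    have fl: "f l = 0" using l zeros by blast
    have "isCont (deriv f) l"
      using holomorphic_on_imp_continuous_on[OF hf'] by (simp add: continuous_on_eq_continuous_at)
    then have "((\<lambda>z. deriv f z / (f z / (z - l)) - (z - l) * zeta z) \<longlongrightarrow> deriv f l / deriv f l - 1) (at l)"
      by (intro tendsto_intros zeta_residue[OF l] simple_zero_quotient[OF hol fl] deriv_zero[OF fl]) (simp add: isCont_def)
    then show ?thesis using deriv_zero[OF fl] by (simp add: right_diff_distrib mult.commute)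
  qed
  ultimately obtain H where H: "H holomorphic_on UNIV" "\<And>z. z \<notin> L \<Longrightarrow> H z = deriv f z / f z - zeta z"
    using holomorphic_extend_discrete[OF L_isolated] by blast
  obtain z0 where z0: "f z0 \<noteq> 0" using nonzero by blast
  have odd_H: "H (- z) = - H z" for z
  proof (rule entire_cancel[where A = "\<lambda>z. H (- z)" and B = "\<lambda>z. - H z", OF _ _ hol z0])
    show "(\<lambda>z. H (- z)) holomorphic_on UNIV"
      by (intro holomorphic_on_compose_gen[OF _ H(1), unfolded o_def] holomorphic_intros) simp
    show "(\<lambda>z. - H z) holomorphic_on UNIV" by (intro holomorphic_intros H)
    fix z
    have "deriv f (- z) = deriv f z"
    proof -
      have "((\<lambda>z. - f (- z)) has_field_derivative deriv f (- z)) (at z)"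
        by (rule derivative_eq_intros DERIV_chain2[OF f_has_deriv] | simp)+
      then show ?thesis using f_has_deriv DERIV_unique by (simp add: odd) blast
    qed
    then have "H (- z) = - H z" if "z \<notin> L"
    proof -
      have "- z \<notin> L" using that L_uminus[of "- z"] by auto
      then show ?thesis using \<open>deriv f (- z) = deriv f z\<close> that by (simp add: H(2) zeta_odd odd)
    qed
    then show "H (- z) * f z = - H z * f z" using zeros[of z] by (cases "z \<in> L") auto
  qed
  \<comment> \<open>A second difference kills the constant by which \<open>f' / f\<close> changes
    under a period.\<close>
  define E where "E h z = H (z + 2 * h) - 2 * H (z + h) + H z" for h z
  have hE: "E h holomorphic_on UNIV" for h
    unfolding E_def by (intro holomorphic_intros holomorphic_shift H)
  have per: "E h (z + u) = E h z" if u: "u \<in> L" for h z u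
  proof -
    have f1: "(\<lambda>z. f (z + h)) holomorphic_on UNIV" and f2: "(\<lambda>z. f (z + 2 * h)) holomorphic_on UNIV"
      by (intro holomorphic_shift hol)+
    obtain z1 where z1: "f z1 * f (z1 + h) \<noteq> 0"
      by (rule entire_mult_nonzero[OF hol f1 z0, of "z0 - h"]) (use z0 in auto)
    have f12: "(\<lambda>z. f z * f (z + h)) holomorphic_on UNIV" by (intro holomorphic_intros hol f1)
    obtain z2 where z2: "f z2 * f (z2 + h) * f (z2 + 2 * h) \<noteq> 0"
      by (rule entire_mult_nonzero[OF f12 f2 z1, of "z0 - 2 * h"]) (use z0 in auto)
    \<comment> \<open>This product vanishes exactly when one of the three points lies in
      \<open>L\<close>; off its zeros \<open>H\<close> has its explicit formula at all of
      them.\<close>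
    have M: "(\<lambda>z. f z * f (z + h) * f (z + 2 * h)) holomorphic_on UNIV"
      by (intro holomorphic_intros f12 f2)
    show ?thesis
    proof (rule entire_cancel[where A = "\<lambda>z. E h (z + u)", OF holomorphic_shift[OF hE] hE M z2])
      fix z
      have "E h (z + u) = E h z" if nz: "f z \<noteq> 0" "f (z + h) \<noteq> 0" "f (z + 2 * h) \<noteq> 0"
      proof -
        have fu: "f u = 0" using u zeros by blast
        have up: "x + u \<notin> L" if "f x \<noteq> 0" for x
          using that L_diff[OF _ u, of "x + u"] zeros by auto
        have nL: "z \<notin> L" "z + h \<notin> L" "z + 2 * h \<notin> L" using nz zeros by auto
        have "z + h + u \<notin> L" "z + 2 * h + u \<notin> L" "z + u \<notin> L" using nz up by auto
        then have nLu: "z + u + h \<notin> L" "z + u + 2 * h \<notin> L" "z + u \<notin> L" by (simp_all add: add_ac)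
        have s: "deriv f (z + u + h) / f (z + u + h) - deriv f (z + h) / f (z + h) = deriv f (z + u) / f (z + u) - deriv f z / f z"
          "deriv f (z + u + 2 * h) / f (z + u + 2 * h) - deriv f (z + 2 * h) / f (z + 2 * h) = deriv f (z + u) / f (z + u) - deriv f z / f z"
          using log_deriv_shift[OF fu nz(2,1)] log_deriv_shift[OF fu nz(3,1)] by (simp_all add: add_ac)
        have "E h (z + u) = (deriv f (z + u + 2 * h) / f (z + u + 2 * h) - 2 * (deriv f (z + u + h) / f (z + u + h)) + deriv f (z + u) / f (z + u))
            - (zeta (z + u + 2 * h) - 2 * zeta (z + u + h) + zeta (z + u))"
          unfolding E_def H(2)[OF nLu(1)] H(2)[OF nLu(2)] H(2)[OF nLu(3)] by (simp add: algebra_simps)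
        also have "deriv f (z + u + 2 * h) / f (z + u + 2 * h) - 2 * (deriv f (z + u + h) / f (z + u + h)) + deriv f (z + u) / f (z + u)
          = deriv f (z + 2 * h) / f (z + 2 * h) - 2 * (deriv f (z + h) / f (z + h)) + deriv f z / f z"
          using s by algebra
        also have "zeta (z + u + 2 * h) - 2 * zeta (z + u + h) + zeta (z + u) = zeta (z + 2 * h) - 2 * zeta (z + h) + zeta z"
          by (rule zeta_second_difference_periodic[OF u])
        also have "deriv f (z + 2 * h) / f (z + 2 * h) - 2 * (deriv f (z + h) / f (z + h)) + deriv f z / f z
            - (zeta (z + 2 * h) - 2 * zeta (z + h) + zeta z) = E h z"
          unfolding E_def H(2)[OF nL(1)] H(2)[OF nL(2)] H(2)[OF nL(3)] by (simp add: algebra_simps)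
        finally show ?thesis .
      qed
      then show "E h (z + u) * (f z * f (z + h) * f (z + 2 * h)) = E h z * (f z * f (z + h) * f (z + 2 * h))"
        by (cases "f z * f (z + h) * f (z + 2 * h) = 0") auto
    qed
  qed
  have hH': "deriv H holomorphic_on UNIV" using H(1) by (simp add: holomorphic_deriv)
  have "deriv H (z + h) + deriv H (z - h) = 2 * deriv H z" for z h
  proof -
    have "E h constant_on UNIV"
      by (rule Liouville_theorem[OF hE lattice_periodic_entire_bounded[OF lattice hE per]])
    then obtain C where C: "E h = (\<lambda>z. C)" by (auto simp: constant_on_def)
    \<comment> \<open>Evaluation at \<open>z - h\<close> centres the second difference of
      \<open>deriv H\<close> at \<open>z\<close>.\<close>
    have "(E h has_field_derivative deriv H (z - h + 2 * h) - 2 * deriv H (z - h + h) + deriv H (z - h)) (at (z - h))"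
      unfolding E_def[abs_def]
      by (rule derivative_eq_intros DERIV_chain2[OF entire_has_deriv[OF H(1)]] entire_has_deriv[OF H(1)] | simp)+
    then have "deriv H (z - h + 2 * h) - 2 * deriv H (z - h + h) + deriv H (z - h) = 0"
      unfolding C using DERIV_unique DERIV_const by blast
    then show ?thesis by (simp add: algebra_simps)
  qed
  then obtain c d where cd: "\<And>z. deriv H z = c * z + d"
    by (rule midpoint_affine[OF hH' zero_less_one]) (rule that)
  have "((\<lambda>z. H z - (c / 2 * z\<^sup>2 + d * z)) has_field_derivative 0) (at z)" for z
    by (rule derivative_eq_intros entire_has_deriv[OF H(1)] | simp add: cd)+
  then obtain e where e: "H z - (c / 2 * z\<^sup>2 + d * z) = e" for z
    using has_field_derivative_0_imp_constant_on[of UNIV "\<lambda>z. H z - (c / 2 * z\<^sup>2 + d * z)"] by (auto simp: constant_on_def)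
  have Hz: "H z = c / 2 * z\<^sup>2 + d * z + e" for z using e[of z] by (simp add: algebra_simps)
  \<comment> \<open>An odd polynomial has neither a constant nor a quadratic term.\<close>
  have "e = 0" using odd_H[of 0] by (simp add: Hz)
  moreover have "c = 0" using odd_H[of 1] \<open>e = 0\<close> by (simp add: Hz)
  ultimately have "H z = d * z" for z by (simp add: Hz)
  then have "deriv f z / f z = d * z + zeta z" if "z \<notin> L" for z
    using H(2)[OF that] by (simp add: algebra_simps)
  then show thesis by (rule that)
qed

text \<open>\<open>T\<close> is the integral of the zeta tail from 0 to \<open>z\<close>. With it,
  the partial product times the exponential has the same logarithmic derivative as \<open>f\<close>
  on a disc without \<open>L\<close>, so the two are proportional.\<close>

lemma sigma_product_approx:
  assumes \<gamma>: "\<And>z. z \<notin> L \<Longrightarrow> deriv f z / f z = \<gamma> * z + zeta z"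
    and \<rho>: "norm z < \<rho>" and R: "2 * \<rho> \<le> R"
  obtains T where "norm T \<le> 2 * \<rho> ^ 3 * tail_mass R"
    "f z = deriv f 0 * (sigma_product {l \<in> L - {0}. norm l \<le> R} z * exp (T + \<gamma> * z\<^sup>2 / 2))"
proof -
  define F where "F = {l \<in> L - {0}. norm l \<le> R}"
  define B where "B = ball (0::complex) \<rho>"
  have \<rho>0: "\<rho> > 0" using \<rho> norm_ge_zero[of z] by linarith
  have finF: "finite F" unfolding F_def by (rule finite_subset[OF _ L_finite[of R]]) auto
  have F0: "insert 0 F = {l \<in> L. norm l \<le> R}" using L_0 R \<rho>0 by (auto simp: F_def)
  have B: "convex B" "open B" "0 \<in> B" "z \<in> B" using \<rho> \<rho>0 by (auto simp: B_def)
  have hol_tail: "tail R holomorphic_on B"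
    by (rule holomorphic_on_subset[OF holomorphic_tail]) (use R in \<open>auto simp: B_def\<close>)
  obtain T where T: "\<And>w. w \<in> B \<Longrightarrow> (T has_field_derivative tail R w) (at w within B)"
    by (rule holomorphic_convex_primitive'[OF B(1,2) hol_tail]) (rule that)
  have T': "(T has_field_derivative tail R w) (at w)" if "w \<in> B" for w
    using T[OF that] by (simp only: at_within_open[OF that B(2)])
  have tail_mass0: "0 \<le> tail_mass R" unfolding tail_mass_def by (intro infsum_nonneg) auto
  have Tbound: "norm (T z - T 0) \<le> 2 * \<rho> ^ 3 * tail_mass R"
  proof -
    have "norm (T z - T 0) \<le> 2 * \<rho>\<^sup>2 * tail_mass R * norm (z - 0)"
    proof (rule field_differentiable_bound[OF B(1) T _ B(4,3)])
      fix w assume w: "w \<in> B"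
      have "norm (tail R w) \<le> 2 * (norm w)\<^sup>2 * tail_mass R"
        by (rule norm_tail_le) (use w R in \<open>simp add: B_def\<close>)
      also have "\<dots> \<le> 2 * \<rho>\<^sup>2 * tail_mass R"
        using w tail_mass0 by (intro mult_right_mono mult_left_mono power_mono) (auto simp: B_def)
      finally show "norm (tail R w) \<le> 2 * \<rho>\<^sup>2 * tail_mass R" .
    qed
    also have "\<dots> \<le> 2 * \<rho>\<^sup>2 * tail_mass R * \<rho>"
      using \<rho> tail_mass0 by (intro mult_left_mono) auto
    finally show ?thesis by (simp add: power2_eq_square power3_eq_cube mult_ac)
  qed
  define X where "X w = sigma_product F w * exp (T w - T 0 + \<gamma> * w\<^sup>2 / 2)" for w
  \<comment> \<open>A disc stays connected after removal of a countable set, so derivative 0 on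
    \<open>B - L\<close> implies constancy.\<close>
  have BL: "open (B - L)" "connected (B - L)"
    using L_closed B(2) connected_open_diff_countable[OF _ B(2) convex_connected[OF B(1)] L_countable] by auto
  have "((\<lambda>w. X w / f w) has_field_derivative 0) (at w)" if w: "w \<in> B - L" for w
  proof -
    have fw: "f w \<noteq> 0" using w zeros by blast
    have w0: "w \<noteq> 0" "w \<notin> F" using w L_0 by (auto simp: F_def)
    have P: "(sigma_product F has_field_derivative sigma_product F w * (\<Sum>l\<in>{l \<in> L. norm l \<le> R}. zeta_term w l)) (at w)"
      using sigma_product_has_deriv[OF finF _ w0] unfolding F0 by (simp add: F_def)
    have "zeta w = (\<Sum>l\<in>{l \<in> L. norm l \<le> R}. zeta_term w l) + tail R w"
      by (rule zeta_split) (use w R in \<open>simp add: B_def\<close>)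
    then have ld: "deriv f w = f w * (\<gamma> * w + (\<Sum>l\<in>{l \<in> L. norm l \<le> R}. zeta_term w l) + tail R w)"
      using \<gamma>[of w] w fw by (simp add: field_simps)
    have E: "((\<lambda>w. exp (T w - T 0 + \<gamma> * w\<^sup>2 / 2)) has_field_derivative
        exp (T w - T 0 + \<gamma> * w\<^sup>2 / 2) * (tail R w + \<gamma> * w)) (at w)"
      by (rule derivative_eq_intros T' | use w in simp)+
    have "(X has_field_derivative X w * (\<gamma> * w + (\<Sum>l\<in>{l \<in> L. norm l \<le> R}. zeta_term w l) + tail R w)) (at w)"
      unfolding X_def[abs_def] by (rule DERIV_cong[OF DERIV_mult[OF P E]]) (simp add: algebra_simps)
    then have "((\<lambda>w. X w / f w) has_field_derivative
       (X w * (\<gamma> * w + (\<Sum>l\<in>{l \<in> L. norm l \<le> R}. zeta_term w l) + tail R w) * f w - X w * deriv f w) / (f w * f w)) (at w)"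
      by (rule DERIV_divide[OF _ f_has_deriv fw])
    then show ?thesis by (simp add: ld mult_ac)
  qed
  then obtain C where C: "\<And>w. w \<in> B - L \<Longrightarrow> X w / f w = C"
    using has_field_derivative_0_imp_constant_on[OF _ BL(2,1)] by (metis constant_on_def)
  then have XC: "X w = C * f w" if "w \<in> B - L" for w
  proof -
    have "f w \<noteq> 0" using that zeros by blast
    then have "X w = X w / f w * f w" by simp
    then show ?thesis unfolding C[OF that] .
  qed
  have "C * deriv f 0 = 1"
  proof -
    \<comment> \<open>\<open>Y w\<close> is \<open>X w / w\<close> with the factor \<open>w\<close>
      cancelled. Comparing \<open>Y 0 = 1\<close> with the limit of \<open>f w / w\<close>
      determines \<open>C\<close>.\<close>
    define Y where "Y w = (\<Prod>l\<in>F. (1 - w / l) * exp (w / l + (w / l)\<^sup>2 / 2)) * exp (T w - T 0 + \<gamma> * w\<^sup>2 / 2)" for w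
    have "isCont T 0" using T'[OF B(3)] DERIV_isCont by blast
    then have "isCont Y 0"
      unfolding Y_def by (intro continuous_intros) (auto simp: F_def)
    then have Y1: "(Y \<longlongrightarrow> 1) (at 0)" by (simp add: isCont_def Y_def)
    have Cf: "((\<lambda>w. C * (f w / (w - 0))) \<longlongrightarrow> C * deriv f 0) (at 0)"
      by (intro tendsto_intros simple_zero_quotient[OF hol f_0])
    have "\<forall>\<^sub>F w in at 0. Y w = C * (f w / (w - 0))"
    proof -
      obtain e where e: "e > 0" "ball 0 e \<inter> L \<subseteq> {0}" using L_isolated by blast
      have "\<forall>\<^sub>F w in at 0. w \<in> (ball 0 e \<inter> B) - {0}"
        by (rule eventually_at_in_open) (use e B in auto)
      then show ?thesis
      proof eventually_elim
        case (elim w)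
        then have "w \<in> B - L" using e by auto
        then have "w * Y w = C * f w" using XC[of w] by (simp add: X_def Y_def sigma_product_def mult_ac)
        then show ?case using elim by (simp add: field_simps)
      qed
    qed
    then have "((\<lambda>w. C * (f w / (w - 0))) \<longlongrightarrow> 1) (at 0)"
      by (rule Lim_transform_eventually[OF Y1])
    then show ?thesis by (rule tendsto_unique[OF trivial_limit_at Cf])
  qed
  have "f z = deriv f 0 * X z"
  proof (cases "z \<in> L")
    case False
    then have "deriv f 0 * X z = (C * deriv f 0) * f z" using XC[of z] B(4) by simp
    then show ?thesis using \<open>C * deriv f 0 = 1\<close> by simp
  next
    case True
    have "sigma_product F z = 0"
    proof (cases "z = 0")
      case False
      then have "z \<in> F" using True \<rho> R \<rho>0 by (simp add: F_def)
      then have "(\<Prod>l\<in>F. (1 - z / l) * exp (z / l + (z / l)\<^sup>2 / 2)) = 0"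
        using False finF by (intro prod_zero) (auto intro!: bexI[of _ z])
      then show ?thesis by (simp add: sigma_product_def)
    qed (simp add: sigma_product_def)
    then show ?thesis using True zeros by (simp add: X_def)
  qed
  then show thesis using Tbound by (intro that[of "T z - T 0"]) (simp_all add: X_def F_def)
qed

text \<open>For fixed \<open>z\<close> the error \<open>T\<close> tends to 0 with
  \<open>tail_mass R\<close>. Solving \<open>sigma_product_approx\<close> for the partial product
  shows that the limit defining sigma exists and gives its value.\<close>

lemma elliptic_case:
  obtains \<alpha> \<beta> where "\<And>z. f z = weierstrass_sigma z L * exp (\<alpha> * z\<^sup>2 + \<beta>)"
proof -
  obtain \<gamma> where \<gamma>: "\<And>z. z \<notin> L \<Longrightarrow> deriv f z / f z = \<gamma> * z + zeta z" using log_deriv_eq by blast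
  have "f z = weierstrass_sigma z L * exp (\<gamma> / 2 * z\<^sup>2 + Ln (deriv f 0))" for z
  proof -
    define \<rho> where "\<rho> = norm z + 1"
    have "\<exists>T. norm T \<le> 2 * \<rho> ^ 3 * tail_mass R \<and>
        f z = deriv f 0 * (sigma_product {l \<in> L - {0}. norm l \<le> R} z * exp (T + \<gamma> * z\<^sup>2 / 2))" if R: "R \<in> {2 * \<rho>..}" for R
    proof -
      have "norm z < \<rho>" "2 * \<rho> \<le> R" using R by (simp_all add: \<rho>_def)
      from sigma_product_approx[OF \<gamma> this] show ?thesis by blast
    qed
    from bchoice[OF ballI[OF this]] obtain T where
      "\<forall>R\<in>{2 * \<rho>..}. norm (T R) \<le> 2 * \<rho> ^ 3 * tail_mass R \<and>
        f z = deriv f 0 * (sigma_product {l \<in> L - {0}. norm l \<le> R} z * exp (T R + \<gamma> * z\<^sup>2 / 2))" ..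
    then have T: "\<And>R. 2 * \<rho> \<le> R \<Longrightarrow> norm (T R) \<le> 2 * \<rho> ^ 3 * tail_mass R"
      "\<And>R. 2 * \<rho> \<le> R \<Longrightarrow> f z = deriv f 0 * (sigma_product {l \<in> L - {0}. norm l \<le> R} z * exp (T R + \<gamma> * z\<^sup>2 / 2))"
      by simp_all
    have ge: "\<forall>\<^sub>F R in at_top. 2 * \<rho> \<le> R" by (rule eventually_ge_at_top)
    have "((\<lambda>R. 2 * \<rho> ^ 3 * tail_mass R) \<longlongrightarrow> 2 * \<rho> ^ 3 * 0) at_top"
      by (intro tendsto_intros tail_mass_tendsto)
    then have T0: "(T \<longlongrightarrow> 0) at_top"
      by (intro Lim_null_comparison[of T "\<lambda>R. 2 * \<rho> ^ 3 * tail_mass R"] eventually_mono[OF ge]) (auto intro: T(1))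
    define c where "c = f z / deriv f 0 * exp (- (\<gamma> * z\<^sup>2 / 2))"
    have "((\<lambda>R. c * exp (- T R)) \<longlongrightarrow> c * exp (- 0)) at_top"
      by (intro tendsto_intros T0)
    moreover have "\<forall>\<^sub>F R in at_top. c * exp (- T R) = sigma_product {l \<in> L - {0}. norm l \<le> R} z"
      using ge
    proof eventually_elim
      case (elim R)
      have "c * exp (- T R) = sigma_product {l \<in> L - {0}. norm l \<le> R} z * (exp (T R + \<gamma> * z\<^sup>2 / 2) * exp (- (\<gamma> * z\<^sup>2 / 2)) * exp (- T R))"
        unfolding c_def using T(2)[OF elim] deriv_0 by (simp add: field_simps)
      also have "exp (T R + \<gamma> * z\<^sup>2 / 2) * exp (- (\<gamma> * z\<^sup>2 / 2)) * exp (- T R) = 1"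
        by (simp flip: exp_add)
      finally show ?case by simp
    qed
    ultimately have "((\<lambda>R. sigma_product {l \<in> L - {0}. norm l \<le> R} z) \<longlongrightarrow> c) at_top"
      by (auto elim: Lim_transform_eventually)
    then have "weierstrass_sigma z L = c"
      unfolding weierstrass_sigma_def sigma_product_def by (intro tendsto_Lim) auto
    \<comment> \<open>The nonzero constant \<open>deriv f 0\<close> enters the exponent through its
      logarithm.\<close>
    moreover have "exp (\<gamma> / 2 * z\<^sup>2 + Ln (deriv f 0)) = exp (\<gamma> * z\<^sup>2 / 2) * deriv f 0"
      using deriv_0 by (simp add: exp_add)
    moreover have "exp (- (\<gamma> * z\<^sup>2 / 2)) * exp (\<gamma> * z\<^sup>2 / 2) = 1"
      by (simp flip: exp_add)
    ultimately show ?thesis using deriv_0 by (simp add: c_def)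
  qed
  then show thesis by (rule that)
qed

end

section \<open>Classification by the group of zeros\<close>

theorem mainTheorem1:
  fixes f :: "complex \<Rightarrow> complex"
  assumes entire: "f holomorphic_on UNIV"
    and odd: "\<forall>z. f (- z) = - f z"
    and nonzero: "\<exists>z. f z \<noteq> 0"
    and fe: "\<forall>x y z w.
      f x * f y * f z * f w
      - f ((x + y + z - w) / 2) * f ((x + y - z + w) / 2) * f ((x - y + z + w) / 2) * f ((- x + y + z + w) / 2)
      - f ((x + y + z + w) / 2) * f ((x + y - z - w) / 2) * f ((x - y + z - w) / 2) * f ((x - y - z + w) / 2)
      = 0"
  shows "\<exists>\<alpha> \<beta> :: complex.
      (\<forall>z. f z = z * exp (\<alpha> * z^2 + \<beta>))
    \<or> (\<exists>a :: complex. a \<noteq> 0 \<and> (\<forall>z. f z = sin (a * z) * exp (\<alpha> * z^2 + \<beta>)))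
    \<or> (\<exists>L. is_lattice L \<and> (\<forall>z. f z = weierstrass_sigma z L * exp (\<alpha> * z^2 + \<beta>)))"
proof -
  interpret three_term_equation f
  proof
    fix a b c d :: complex
    have half: "(a + b + (a - b) + (c + d) - (c - d)) / 2 = a + d" "(a + b + (a - b) - (c + d) + (c - d)) / 2 = a - d"
      "(a + b - (a - b) + (c + d) + (c - d)) / 2 = c + b" "(- (a + b) + (a - b) + (c + d) + (c - d)) / 2 = c - b"
      "(a + b + (a - b) + (c + d) + (c - d)) / 2 = a + c" "(a + b + (a - b) - (c + d) - (c - d)) / 2 = a - c"
      "(a + b - (a - b) + (c + d) - (c - d)) / 2 = b + d" "(a + b - (a - b) - (c + d) + (c - d)) / 2 = b - d"
      by (simp_all add: field_simps)
    show "f (a + b) * f (a - b) * f (c + d) * f (c - d)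
      = f (a + d) * f (a - d) * f (c + b) * f (c - b) + f (a + c) * f (a - c) * f (b + d) * f (b - d)"
      using fe[rule_format, of "a + b" "a - b" "c + d" "c - d"] unfolding half by (simp add: algebra_simps)
  qed (use entire odd nonzero in auto)
  let ?L = "{z. f z = 0}"
  obtain z0 where z0: "f z0 \<noteq> 0" using nonzero by blast
  have "0 \<in> ?L" by (simp add: f_0)
  moreover have "x - y \<in> ?L" if "x \<in> ?L" "y \<in> ?L" for x y
    using that zero_add_diff(2)[of y x] by simp
  moreover have "finite {z. z \<in> ?L \<and> norm z \<le> r}" for r
    using entire_zeros_finite[OF entire z0] by simp
  ultimately consider "?L = {0}" | w where "w \<noteq> 0" "?L = {of_int n * w | n :: int. True}" | "is_lattice ?L"
    by (rule discrete_subgroup_cases)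
  then show ?thesis
  proof cases
    case 1
    then show ?thesis using rational_case by metis
  next
    case (2 w)
    then show ?thesis using trigonometric_case by metis
  next
    case 3
    interpret lattice_zeros f ?L
      by unfold_locales (use 3 in auto)
    show ?thesis using elliptic_case 3 by metis
  qed
qed

end
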